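(* Let $(X,\|\cdot\|_X)$ be a $K$-convex complex Banach space. For every $p\in(1,\infty)$, there exist $\alpha(p,X)\in[1,2)$ and $C(p,X)\in(0,\infty)$ such that for every $n,d\in\mathbb{N}$ with $d\in\{1,\ldots,n\}$ and every function $f:\{-1,1\}^n\to X$ of degree at most $d$, we have $$\|\Delta f\|_{L_p(\{-1,1\}^n;X)}\leq C(p,X)\,d^{\alpha(p,X)}\,\|f\|_{L_p(\{-1,1\}^n;X)}.$$
   Context: $\mathbb{N}=\{1,2,\ldots\}$. For $p\in[1,\infty)$, $\|f\|_{L_p(\{-1,1\}^n;X)}=\big(2^{-n}\sum_{\varepsilon\in\{-1,1\}^n}\|f(\varepsilon)\|_X^p\big)^{1/p}$. For $A\subseteq\{1,\ldots,n\}$, the Walsh function is $w_A(\varepsilon)=\prod_{i\in A}\varepsilon_i$. Every $f:\{-1,1\}^n\to X$ has the expansion $f=\sum_{A}\widehat f(A)w_A$ with $\widehat f(A)=2^{-n}\sum_{\delta\in\{-1,1\}^n}f(\delta)w_A(\delta)\in X$. The hypercube Laplacian is $\Delta f=\sum_A|A|\widehat f(A)w_A$. A function $f$ has degree at most $d$ if $\widehat f(A)=0$ whenever $|A|>d$. The Rademacher projection is $\mathsf{Rad}(f)(\varepsilon)=\sum_{i=1}^n\widehat f(\{i\})\varepsilon_i$. $X$ is $K$-convex if $\sup_{n\in\mathbb{N}}\|\mathsf{Rad}\|_{L_p(\{-1,1\}^n;X)\to L_p(\{-1,1\}^n;X)}<\infty$ for some (equivalently, for all) $p\in(1,\infty)$.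 *)

theory Defs
  imports Complex_Main "HOL-Library.FuncSet" "HOL-Library.Extended_Real"
begin

class complex_banach = banach +
  fixes scaleC :: "complex \<Rightarrow> 'a \<Rightarrow> 'a" (infixr "*\<^sub>C" 75)
  assumes scaleC_add_right: "a *\<^sub>C (x + y) = a *\<^sub>C x + a *\<^sub>C y"
    and scaleC_add_left: "(a + b) *\<^sub>C x = a *\<^sub>C x + b *\<^sub>C x"
    and scaleC_scaleC: "a *\<^sub>C (b *\<^sub>C x) = (a * b) *\<^sub>C x"
    and scaleC_one: "1 *\<^sub>C x = x"
    and scaleR_scaleC: "r *\<^sub>R x = complex_of_real r *\<^sub>C x"
    and norm_scaleC: "norm (a *\<^sub>C x) = cmod a * norm x"

instantiation complex :: complex_banach
begin

definition scaleC_complex :: "complex \<Rightarrow> complex \<Rightarrow> complex" where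
  "scaleC_complex a x = a * x"

instance
  by standard (simp_all add: scaleC_complex_def algebra_simps norm_mult scaleR_conv_of_real)

end

text \<open>A function on the cube is represented by a total function of which only the values on
  \<^term>\<open>cube n\<close> are ever used.\<close>

definition cube :: "nat \<Rightarrow> (nat \<Rightarrow> real) set" where
  "cube n = {1..n} \<rightarrow>\<^sub>E {-1, 1}"

definition Lp_norm :: "real \<Rightarrow> nat \<Rightarrow> ((nat \<Rightarrow> real) \<Rightarrow> 'a::real_normed_vector) \<Rightarrow> real" where
  "Lp_norm p n f = ((\<Sum>\<epsilon>\<in>cube n. norm (f \<epsilon>) powr p) / 2 ^ n) powr (1 / p)"

definition walsh :: "nat set \<Rightarrow> (nat \<Rightarrow> real) \<Rightarrow> real" where
  "walsh A \<epsilon> = (\<Prod>i\<in>A. \<epsilon> i)"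

definition walsh_coeff ::
    "nat \<Rightarrow> ((nat \<Rightarrow> real) \<Rightarrow> 'a::real_normed_vector) \<Rightarrow> nat set \<Rightarrow> 'a" where
  "walsh_coeff n f A = (1 / 2 ^ n) *\<^sub>R (\<Sum>\<delta>\<in>cube n. walsh A \<delta> *\<^sub>R f \<delta>)"

definition laplacian ::
    "nat \<Rightarrow> ((nat \<Rightarrow> real) \<Rightarrow> 'a::real_normed_vector) \<Rightarrow> (nat \<Rightarrow> real) \<Rightarrow> 'a" where
  "laplacian n f \<epsilon> =
     (\<Sum>A\<in>Pow {1..n}. real (card A) *\<^sub>R (walsh A \<epsilon> *\<^sub>R walsh_coeff n f A))"

definition degree_at_most ::
    "nat \<Rightarrow> nat \<Rightarrow> ((nat \<Rightarrow> real) \<Rightarrow> 'a::real_normed_vector) \<Rightarrow> bool" where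
  "degree_at_most n d f \<longleftrightarrow> (\<forall>A. A \<subseteq> {1..n} \<and> card A > d \<longrightarrow> walsh_coeff n f A = 0)"

definition rademacher_proj ::
    "nat \<Rightarrow> ((nat \<Rightarrow> real) \<Rightarrow> 'a::real_normed_vector) \<Rightarrow> (nat \<Rightarrow> real) \<Rightarrow> 'a" where
  "rademacher_proj n f \<epsilon> = (\<Sum>i=1..n. \<epsilon> i *\<^sub>R walsh_coeff n f {i})"

text \<open>The operator norm is the supremum over the unit ball, taken in the extended reals so that
  finiteness of the supremum over all dimensions can be expressed directly.\<close>

definition rademacher_opnorm :: "'a::real_normed_vector itself \<Rightarrow> real \<Rightarrow> nat \<Rightarrow> ereal" where
  "rademacher_opnorm _ p n =
     (SUP f\<in>{f :: (nat \<Rightarrow> real) \<Rightarrow> 'a. Lp_norm p n f \<le> 1}. ereal (Lp_norm p n (rademacher_proj n f)))"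

definition K_convex :: "'a::real_normed_vector itself \<Rightarrow> bool" where
  "K_convex X \<longleftrightarrow> (\<exists>p>1. (SUP n\<in>{1..}. rademacher_opnorm X p n) < \<infinity>)"

end

theory Submission
  imports Defs "HOL-Complex_Analysis.Complex_Analysis"
begin

text \<open>Write \<open>f = f\<^sub>0 + \<dots> + f\<^sub>d\<close> with \<open>f\<^sub>k\<close> the part of \<open>f\<close> of Walsh degree exactly \<open>k\<close>, so that the
Laplacian \<open>\<Delta>\<close> multiplies \<open>f\<^sub>k\<close> by \<open>k\<close>. The proof studies the resolvent
\<open>U(w) = (1 - w \<Delta>)\<^sup>-\<^sup>1 f\<close>, the sum of the \<open>f\<^sub>k / (1 - w k)\<close>. It satisfies \<open>U'(0) = \<Delta> f\<close>, and because \<open>f\<close>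
has degree at most \<open>d\<close> its only poles are \<open>1, 1/2, \<dots>, 1/d\<close>. If \<open>U\<close> is bounded by a multiple of the
norm of \<open>f\<close> on a disc of radius \<open>r\<close> about \<open>0\<close>, then Cauchy's estimate gives
\<open>\<parallel>\<Delta> f\<parallel> \<le> C / r \<cdot> \<parallel>f\<parallel>\<close>; the theorem says that \<open>r\<close> can be a multiple of \<open>d powr -\<alpha>\<close> with \<open>\<alpha> < 2\<close>.\<close>

text \<open>\<^emph>\<open>What K-convexity gives.\<close> It excludes almost isometric copies of \<open>\<ell>\<^sub>1\<close> of large
dimension: on vectors indexed by a cube that behave like the unit basis of \<open>\<ell>\<^sub>1\<close>, the Rademacher
projection has norm of order \<open>sqrt m\<close>. In the quantitative form \<open>K_convex_sign_sums\<close> this passes from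
the exponent in the definition of K-convexity to an arbitrary \<open>p > 1\<close>. Following Pisier, if
\<open>P\<^sub>1, \<dots>, P\<^sub>N\<close> are commuting contractive projections and the product of the \<open>1 - P\<^sub>j\<close> had norm close
to the trivial bound \<open>2 ^ N\<close> at \<open>f\<close>, then the vectors \<open>P\<^sub>j f\<close> would be such a copy. Hence that product has
norm at most \<open>q \<cdot> 2 ^ N\<close> with \<open>q < 1\<close> (\<open>prod_hit_le\<close>). The noise operator \<open>T\<close> with
parameter \<open>\<rho>\<close>, which multiplies \<open>f\<^sub>k\<close> by \<open>\<rho> ^ k\<close>, averages the conditional expectations
that integrate out a random set of coordinates; expanding \<open>(1 - T) ^ N\<close> over independent random sets gives
\<open>\<parallel>(1 - T) ^ N\<parallel> \<le> q \<cdot> 2 ^ N\<close>, uniformly in \<open>n\<close> and \<open>\<rho>\<close> (\<open>noise_power_gap\<close>).\<close>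

text \<open>\<^emph>\<open>From there to the theorem.\<close> The last bound makes \<open>1 + T\<close> boundedly invertible. An argument of Kato turns
this into a bound for \<open>(1 - w \<Delta>)\<^sup>-\<^sup>1\<close> on the imaginary axis (\<open>le_resolvent_imaginary\<close>), and perturbation
extends it to all \<open>w\<close> outside a double cone around the real axis with half-angle less than \<open>pi / 2\<close>
(\<open>le_resolvent_sector\<close>). On the disc \<open>\<bar>w\<bar> \<le> 1/(2d)\<close> there is a crude bound of size \<open>exp (O(d ln d))\<close>
(\<open>resolvent_small_disc\<close>). The cone is so narrow that \<open>Re (w powr \<beta>)\<close> is positive on it for some \<open>\<beta> > 1\<close>; comparing
\<open>ln \<parallel>U\<parallel>\<close> with a multiple of this harmonic function by the maximum principle (\<open>resolvent_corner\<close>)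
shows that \<open>U\<close> is bounded up to \<open>\<bar>w\<bar>\<close> of order \<open>d\<^sup>-\<^sup>1 (d ln d) powr (-1/\<beta>)\<close>. This yields every
\<open>\<alpha> > 1 + 1/\<beta>\<close>, in particular some \<open>\<alpha> < 2\<close>.\<close>

section \<open>Convexity of powers\<close>

lemma powr_ge_tangent:
  fixes t p :: real
  assumes "1 \<le> p" "0 \<le> t"
  shows "1 + p * (t - 1) \<le> t powr p"
proof (cases "t = 0")
  case True
  then show ?thesis using assms by simp
next
  case False
  have "p * 1 powr (p - 1) * (t - 1) \<le> t powr p - 1 powr p"
    by (rule f''_imp_f'[where C = "{0<..}" and f'' = "\<lambda>x. p * ((p - 1) * x powr (p - 2))"])
       (use assms False in \<open>auto intro!: derivative_eq_intros simp: diff_diff_eq\<close>)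
  then show ?thesis by simp
qed

text \<open>Strict convexity in the form used below: for \<open>t \<ge> 2\<close> the function lies above its tangent at \<open>1\<close> by a fixed
positive amount, so numbers with \<open>p\<close>-th power mean \<open>1\<close> and mean near \<open>1\<close> are all at most \<open>2\<close>.\<close>

lemma powr_gt_tangent:
  fixes t p :: real
  assumes "1 < p" "2 \<le> t"
  shows "2 powr p - 1 - p \<le> t powr p - 1 - p * (t - 1)"
    and "0 < 2 powr p - 1 - p"
proof -
  have "2 powr p + p * (t - 2) \<le> 2 powr p + 2 powr (p - 1) * (p * (t - 2))"
    using assms ge_one_powr_ge_zero[of 2 "p - 1"] mult_right_mono[of 1 "2 powr (p - 1)" "p * (t - 2)"] by simp
  also have "\<dots> = 2 powr p * (1 + p * (t / 2 - 1))"
    by (simp add: powr_diff field_simps)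
  also have "\<dots> \<le> 2 powr p * (t / 2) powr p"
    using assms by (intro mult_left_mono powr_ge_tangent) auto
  also have "\<dots> = t powr p"
    using assms by (simp flip: powr_mult)
  finally show "2 powr p - 1 - p \<le> t powr p - 1 - p * (t - 1)" by (simp add: algebra_simps)
next
  let ?s = "sqrt 2"
  have "?s < 3/2" by (rule real_less_lsqrt) (auto simp: power2_eq_square)
  then have s: "1 < ?s" "?s * ?s = 2" "?s < 3/2" by auto
  have "(1 + p * (?s - 1))\<^sup>2 \<le> (?s powr p)\<^sup>2"
    using assms s by (intro power_mono powr_ge_tangent) auto
  also have "\<dots> = 2 powr p" by (simp add: power2_eq_square flip: powr_mult)
  finally have "(1 + p * (?s - 1))\<^sup>2 \<le> 2 powr p" .
  moreover have "(1 + p * (?s - 1))\<^sup>2 - 1 - p = p * (p - 1) * (3 - 2 * ?s)"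
    using s(2) by (simp add: power2_eq_square algebra_simps)
  moreover have "0 < p * (p - 1) * (3 - 2 * ?s)"
    using assms s by simp
  ultimately show "0 < 2 powr p - 1 - p" by linarith
qed

text \<open>Jensen's inequality, obtained by averaging the tangent inequality at the mean. Minkowski's inequality below uses
it for two points and the comparison of moments for uniform weights.\<close>

lemma powr_weighted_mean_le:
  fixes w a :: "'i \<Rightarrow> real"
  assumes "1 \<le> p" "\<And>i. i \<in> I \<Longrightarrow> 0 \<le> w i" "sum w I = 1" "\<And>i. i \<in> I \<Longrightarrow> 0 \<le> a i"
  shows "(\<Sum>i\<in>I. w i * a i) powr p \<le> (\<Sum>i\<in>I. w i * a i powr p)"
proof -
  define \<mu> where "\<mu> = (\<Sum>i\<in>I. w i * a i)"
  have "\<mu> \<ge> 0" unfolding \<mu>_def using assms by (intro sum_nonneg) auto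
  show ?thesis
  proof (cases "\<mu> = 0")
    case True
    then show ?thesis using assms by (auto simp flip: \<mu>_def intro!: sum_nonneg)
  next
    case False
    with \<open>\<mu> \<ge> 0\<close> have "\<mu> > 0" by simp
    have "1 = (\<Sum>i\<in>I. w i * (1 + p * (a i / \<mu> - 1)))"
    proof -
      have "(\<Sum>i\<in>I. w i * (1 + p * (a i / \<mu> - 1))) = (\<Sum>i\<in>I. (1 - p) * w i + p / \<mu> * (w i * a i))"
        by (intro sum.cong) (auto simp: algebra_simps)
      also have "\<dots> = (1 - p) * sum w I + p / \<mu> * \<mu>"
        by (simp only: sum.distrib sum_distrib_left \<mu>_def)
      finally show ?thesis using assms(3) \<open>\<mu> > 0\<close> by simp
    qed
    also have "\<dots> \<le> (\<Sum>i\<in>I. w i * (a i / \<mu>) powr p)"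
      using assms \<open>\<mu> > 0\<close> by (intro sum_mono mult_left_mono powr_ge_tangent) auto
    also have "\<dots> = (\<Sum>i\<in>I. w i * a i powr p) / \<mu> powr p"
      using assms \<open>\<mu> > 0\<close> by (simp add: powr_divide sum_divide_distrib)
    finally show ?thesis using \<open>\<mu> > 0\<close> unfolding \<mu>_def[symmetric] by (simp add: field_simps)
  qed
qed

lemma powr_mean_le:
  fixes a :: "'i \<Rightarrow> real"
  assumes "1 \<le> p" "finite I" "I \<noteq> {}" "\<And>i. i \<in> I \<Longrightarrow> 0 \<le> a i"
  shows "((\<Sum>i\<in>I. a i) / card I) powr p \<le> (\<Sum>i\<in>I. a i powr p) / card I"
  using powr_weighted_mean_le[of p I "\<lambda>_. 1 / card I" a] assms
  by (simp flip: sum_divide_distrib)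

section \<open>The cube and its Lp norms\<close>

lemma finite_cube [simp, intro]: "finite (cube n)"
  unfolding cube_def by (intro finite_PiE) auto

lemma card_cube: "card (cube n) = 2 ^ n"
  unfolding cube_def by (subst card_PiE) (auto simp: numeral_2_eq_2)

lemma cube_nonempty: "cube n \<noteq> {}"
  using card_cube[of n] by (metis card.empty power_not_zero zero_neq_numeral)

lemma cubeD: "\<epsilon> \<in> cube n \<Longrightarrow> i \<in> {1..n} \<Longrightarrow> \<epsilon> i = 1 \<or> \<epsilon> i = -1"
  unfolding cube_def by fastforce

lemma cube_square: "\<epsilon> \<in> cube n \<Longrightarrow> i \<in> {1..n} \<Longrightarrow> \<epsilon> i * \<epsilon> i = 1"
  using cubeD by fastforce

lemma sum_cube_Suc:
  "(\<Sum>\<epsilon>\<in>cube (Suc m). g \<epsilon>) = (\<Sum>\<epsilon>\<in>cube m. g (\<epsilon>(Suc m := 1)) + g (\<epsilon>(Suc m := -1)))"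
proof -
  have eq: "cube (Suc m) = (\<lambda>(y, \<epsilon>). \<epsilon>(Suc m := y)) ` ({-1, 1} \<times> cube m)"
    unfolding cube_def by (subst PiE_insert_eq[symmetric]) (simp add: atLeastAtMostSuc_conv)
  have "(\<Sum>\<epsilon>\<in>cube (Suc m). g \<epsilon>) = (\<Sum>(y, \<epsilon>)\<in>{-1, 1} \<times> cube m. g (\<epsilon>(Suc m := y)))"
    unfolding eq by (subst sum.reindex) (auto simp: cube_def intro!: inj_combinator sum.cong)
  also have "\<dots> = (\<Sum>y\<in>{-1, 1}. \<Sum>\<epsilon>\<in>cube m. g (\<epsilon>(Suc m := y)))"
    by (simp add: sum.cartesian_product)
  finally show ?thesis by (simp add: sum.distrib add.commute)
qed

lemma Lp_norm_nonneg: "0 \<le> Lp_norm p n f"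
  by (simp add: Lp_norm_def)

lemma Lp_norm_le_iff:
  assumes "0 < p" "0 \<le> B"
  shows "Lp_norm p n f \<le> B \<longleftrightarrow> (\<Sum>\<epsilon>\<in>cube n. norm (f \<epsilon>) powr p) \<le> 2 ^ n * B powr p"
proof -
  let ?s = "(\<Sum>\<epsilon>\<in>cube n. norm (f \<epsilon>) powr p) / 2 ^ n"
  have s: "0 \<le> ?s" by (auto intro!: sum_nonneg divide_nonneg_pos)
  have "?s powr (1/p) \<le> B \<longleftrightarrow> (?s powr (1/p)) powr p \<le> B powr p"
    using assms powr_mono2[of p "?s powr (1/p)" B] powr_less_mono2[of p B "?s powr (1/p)"]
    by (auto simp: not_le[symmetric])
  also have "(?s powr (1/p)) powr p = ?s" using s assms by (simp add: powr_powr sum_nonneg)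
  finally show ?thesis by (simp add: Lp_norm_def field_simps)
qed

lemma Lp_norm_cong:
  "(\<And>\<epsilon>. \<epsilon> \<in> cube n \<Longrightarrow> f \<epsilon> = g \<epsilon>) \<Longrightarrow> Lp_norm p n f = Lp_norm p n g"
  by (simp add: Lp_norm_def)

lemma Lp_norm_scale:
  assumes "0 < p" "0 \<le> c" "\<And>\<epsilon>. \<epsilon> \<in> cube n \<Longrightarrow> norm (f \<epsilon>) = c * norm (g \<epsilon>)"
  shows "Lp_norm p n f = c * Lp_norm p n g"
proof -
  have "(\<Sum>\<epsilon>\<in>cube n. norm (f \<epsilon>) powr p) = c powr p * (\<Sum>\<epsilon>\<in>cube n. norm (g \<epsilon>) powr p)"
    using assms by (simp add: powr_mult sum_distrib_left)
  then show ?thesis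
    using assms by (simp add: Lp_norm_def powr_mult powr_powr powr_divide sum_nonneg)
qed

text \<open>Minkowski's inequality: scaled to the unit ball, it is the convexity of the \<open>p\<close>-th power. The proof enlarges both norms
by \<open>e / 2\<close> to avoid division by zero.\<close>

lemma Lp_norm_triangle:
  assumes "1 \<le> p"
  shows "Lp_norm p n (\<lambda>\<epsilon>. f \<epsilon> + g \<epsilon>) \<le> Lp_norm p n f + Lp_norm p n g"
proof (rule field_le_epsilon)
  fix e :: real assume e: "0 < e"
  define A B where "A = Lp_norm p n f + e / 2" and "B = Lp_norm p n g + e / 2"
  have AB: "A > 0" "B > 0" using e Lp_norm_nonneg[of p n f] Lp_norm_nonneg[of p n g] by (auto simp: A_def B_def)
  have f: "(\<Sum>\<epsilon>\<in>cube n. norm (f \<epsilon>) powr p) \<le> 2 ^ n * A powr p"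
    using assms e AB by (subst Lp_norm_le_iff[symmetric]) (auto simp: A_def)
  have g: "(\<Sum>\<epsilon>\<in>cube n. norm (g \<epsilon>) powr p) \<le> 2 ^ n * B powr p"
    using assms e AB by (subst Lp_norm_le_iff[symmetric]) (auto simp: B_def)
  have pt: "norm (f \<epsilon> + g \<epsilon>) powr p \<le>
      (A + B) powr p * (A / (A + B) * (norm (f \<epsilon>) powr p / A powr p) + B / (A + B) * (norm (g \<epsilon>) powr p / B powr p))" for \<epsilon>
  proof -
    have "norm (f \<epsilon> + g \<epsilon>) powr p \<le> (norm (f \<epsilon>) + norm (g \<epsilon>)) powr p"
      using assms by (intro powr_mono2 norm_triangle_ineq) auto
    also have "norm (f \<epsilon>) + norm (g \<epsilon>) = (A + B) * (A / (A + B) * (norm (f \<epsilon>) / A) + B / (A + B) * (norm (g \<epsilon>) / B))"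
    proof -
      have "(A + B) * (A / (A + B) * x) = A * x" "(A + B) * (B / (A + B) * x) = B * x" for x
        using AB by simp_all
      then show ?thesis using AB by (simp only: distrib_left) simp
    qed
    also have "\<dots> powr p = (A + B) powr p * (A / (A + B) * (norm (f \<epsilon>) / A) + B / (A + B) * (norm (g \<epsilon>) / B)) powr p"
      by (rule powr_mult)
    also have "\<dots> \<le> (A + B) powr p * (A / (A + B) * (norm (f \<epsilon>) / A) powr p + B / (A + B) * (norm (g \<epsilon>) / B) powr p)"
    proof (rule mult_left_mono)
      have "B / (A + B) + A / (A + B) = 1"
        using AB by (simp flip: add_divide_distrib)
      then show "(A / (A + B) * (norm (f \<epsilon>) / A) + B / (A + B) * (norm (g \<epsilon>) / B)) powr p
          \<le> A / (A + B) * (norm (f \<epsilon>) / A) powr p + B / (A + B) * (norm (g \<epsilon>) / B) powr p"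
        using AB assms powr_weighted_mean_le[of p UNIV "\<lambda>b. if b then A / (A + B) else B / (A + B)"
            "\<lambda>b. if b then norm (f \<epsilon>) / A else norm (g \<epsilon>) / B"]
        by (simp add: UNIV_bool add.commute)
    qed simp
    finally show ?thesis using AB by (simp add: powr_divide)
  qed
  have "(\<Sum>\<epsilon>\<in>cube n. norm (f \<epsilon> + g \<epsilon>) powr p) \<le> (\<Sum>\<epsilon>\<in>cube n.
      (A + B) powr p * (A / (A + B) * (norm (f \<epsilon>) powr p / A powr p) + B / (A + B) * (norm (g \<epsilon>) powr p / B powr p)))"
    by (intro sum_mono pt)
  also have "\<dots> =
     (A + B) powr p * (A / (A + B) * ((\<Sum>\<epsilon>\<in>cube n. norm (f \<epsilon>) powr p) / A powr p) + B / (A + B) * ((\<Sum>\<epsilon>\<in>cube n. norm (g \<epsilon>) powr p) / B powr p))"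
    by (simp only: sum_distrib_left[symmetric] sum.distrib sum_divide_distrib[symmetric])
  also have "\<dots> \<le> (A + B) powr p * (A / (A + B) * 2 ^ n + B / (A + B) * 2 ^ n)"
    using AB f g by (intro mult_left_mono add_mono) (auto simp: field_simps)
  also have "A / (A + B) * 2 ^ n + B / (A + B) * 2 ^ n = (A + B) / (A + B) * 2 ^ n"
    by (simp only: add_divide_distrib distrib_right)
  also have "\<dots> = 2 ^ n" using AB by simp
  finally have "Lp_norm p n (\<lambda>\<epsilon>. f \<epsilon> + g \<epsilon>) \<le> A + B"
    using AB assms by (subst Lp_norm_le_iff) (auto simp: mult.commute)
  then show "Lp_norm p n (\<lambda>\<epsilon>. f \<epsilon> + g \<epsilon>) \<le> Lp_norm p n f + Lp_norm p n g + e"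
    by (simp add: A_def B_def)
qed

lemma Lp_norm_sum:
  assumes "1 \<le> p" "finite I"
  shows "Lp_norm p n (\<lambda>\<epsilon>. \<Sum>i\<in>I. f i \<epsilon>) \<le> (\<Sum>i\<in>I. Lp_norm p n (f i))"
  using assms(2)
proof (induction I rule: finite_induct)
  case empty
  then show ?case by (simp add: Lp_norm_def)
next
  case (insert i I)
  then show ?case using Lp_norm_triangle[OF assms(1), of n "f i" "\<lambda>\<epsilon>. \<Sum>i\<in>I. f i \<epsilon>"] by simp
qed

section \<open>K-convexity excludes large copies of the space of summable sequences\<close>

text \<open>K-convexity with respect to an unspecified exponent, weakened to a bound between the two extreme norms. This form does not
mention the exponent any more, which is what permits the change of exponent later.\<close>

lemma K_convex_mean_bound:
  assumes "K_convex TYPE('a::real_normed_vector)"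
  obtains K where "0 \<le> K"
    "\<And>m (v :: (nat \<Rightarrow> real) \<Rightarrow> 'a). 1 \<le> m \<Longrightarrow> (\<And>\<delta>. \<delta> \<in> cube m \<Longrightarrow> norm (v \<delta>) \<le> 1) \<Longrightarrow>
       (\<Sum>\<epsilon>\<in>cube m. norm (rademacher_proj m v \<epsilon>)) \<le> K * 2 ^ m"
proof -
  obtain r where r: "1 < r" and fin: "(SUP n\<in>{1..}. rademacher_opnorm TYPE('a) r n) < \<infinity>"
    using assms unfolding K_convex_def by blast
  define S where "S = (SUP n\<in>{1..}. rademacher_opnorm TYPE('a) r n)"
  define K where "K = max 0 (real_of_ereal S)"
  show thesis
  proof
    show "0 \<le> K" by (simp add: K_def)
    fix m and v :: "(nat \<Rightarrow> real) \<Rightarrow> 'a"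
    assume m: "1 \<le> m" and v: "\<And>\<delta>. \<delta> \<in> cube m \<Longrightarrow> norm (v \<delta>) \<le> 1"
    have "(\<Sum>\<delta>\<in>cube m. norm (v \<delta>) powr r) \<le> (\<Sum>\<delta>\<in>cube m. 1)"
      using v r by (intro sum_mono powr_le1) auto
    then have "Lp_norm r m v \<le> 1"
      using r by (subst Lp_norm_le_iff) (auto simp: card_cube)
    then have "ereal (Lp_norm r m (rademacher_proj m v)) \<le> rademacher_opnorm TYPE('a) r m"
      unfolding rademacher_opnorm_def by (intro SUP_upper) auto
    also have "\<dots> \<le> S" unfolding S_def using m by (intro SUP_upper) auto
    finally have "Lp_norm r m (rademacher_proj m v) \<le> K"
      using fin unfolding K_def S_def[symmetric] by (cases S) auto
    then have "(\<Sum>\<epsilon>\<in>cube m. norm (rademacher_proj m v \<epsilon>) powr r) / 2 ^ m \<le> K powr r"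
      using r \<open>0 \<le> K\<close> by (subst (asm) Lp_norm_le_iff) (auto simp: field_simps)
    moreover have "((\<Sum>\<epsilon>\<in>cube m. norm (rademacher_proj m v \<epsilon>)) / 2 ^ m) powr r
        \<le> (\<Sum>\<epsilon>\<in>cube m. norm (rademacher_proj m v \<epsilon>) powr r) / 2 ^ m"
      using powr_mean_le[of r "cube m" "\<lambda>\<epsilon>. norm (rademacher_proj m v \<epsilon>)"] r cube_nonempty
      by (simp add: card_cube)
    ultimately have "\<not> K < (\<Sum>\<epsilon>\<in>cube m. norm (rademacher_proj m v \<epsilon>)) / 2 ^ m"
      using powr_less_mono2[of r K] r \<open>0 \<le> K\<close> by fastforce
    then show "(\<Sum>\<epsilon>\<in>cube m. norm (rademacher_proj m v \<epsilon>)) \<le> K * 2 ^ m"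
      by (simp add: field_simps)
  qed
qed

definition cube_inner :: "nat \<Rightarrow> (nat \<Rightarrow> real) \<Rightarrow> (nat \<Rightarrow> real) \<Rightarrow> real" where
  "cube_inner m \<epsilon> \<delta> = (\<Sum>i=1..m. \<epsilon> i * \<delta> i)"

definition sign_of :: "real \<Rightarrow> real" where
  "sign_of t = (if 0 \<le> t then 1 else -1)"

lemma sign_of_mult_abs: "sign_of t * \<bar>t\<bar> = t" and abs_sign_of [simp]: "\<bar>sign_of t\<bar> = 1"
  by (auto simp: sign_of_def)

lemma rademacher_proj_eq_cube_inner:
  "rademacher_proj m v \<epsilon> = (1 / 2 ^ m) *\<^sub>R (\<Sum>\<delta>\<in>cube m. cube_inner m \<epsilon> \<delta> *\<^sub>R v \<delta>)"
proof -
  have "rademacher_proj m v \<epsilon> = (\<Sum>i=1..m. (1 / 2 ^ m) *\<^sub>R (\<Sum>\<delta>\<in>cube m. (\<epsilon> i * \<delta> i) *\<^sub>R v \<delta>))"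
    by (simp add: rademacher_proj_def walsh_coeff_def walsh_def scaleR_sum_right mult_ac)
  also have "\<dots> = (1 / 2 ^ m) *\<^sub>R (\<Sum>\<delta>\<in>cube m. \<Sum>i=1..m. (\<epsilon> i * \<delta> i) *\<^sub>R v \<delta>)"
    by (subst sum.swap) (simp add: scaleR_sum_right)
  finally show ?thesis by (simp add: cube_inner_def scaleR_sum_left)
qed

text \<open>Second and fourth moments of a sum of independent signs, by induction on the number of signs. Flipping signs by the fixed vector
\<open>\<delta>\<close> does not change the distribution.\<close>

lemma cube_inner_moments:
  assumes "\<And>i. i \<in> {1..m} \<Longrightarrow> \<delta> i * \<delta> i = 1"
  shows "(\<Sum>\<epsilon>\<in>cube m. (cube_inner m \<epsilon> \<delta>)\<^sup>2) = real m * 2 ^ m"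
    and "(\<Sum>\<epsilon>\<in>cube m. cube_inner m \<epsilon> \<delta> ^ 4) = (3 * (real m)\<^sup>2 - 2 * real m) * 2 ^ m"
  using assms
proof (induction m)
  case 0
  { case 1 show ?case by (simp add: cube_inner_def) }
  { case 2 show ?case by (simp add: cube_inner_def) }
next
  case (Suc m)
  define t where "t = \<delta> (Suc m)"
  have upd: "cube_inner (Suc m) (\<epsilon>(Suc m := y)) \<delta> = cube_inner m \<epsilon> \<delta> + y * t" for \<epsilon> y
    by (simp add: cube_inner_def t_def)
  { case 1
    then have t: "t * t = 1" by (simp add: t_def)
    have *: "(x + 1 * t)\<^sup>2 + (x + -1 * t)\<^sup>2 = 2 * x\<^sup>2 + 2" for x
      using t by algebra
    have "(\<Sum>\<epsilon>\<in>cube (Suc m). (cube_inner (Suc m) \<epsilon> \<delta>)\<^sup>2) = 2 * (\<Sum>\<epsilon>\<in>cube m. (cube_inner m \<epsilon> \<delta>)\<^sup>2) + 2 * 2 ^ m"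
      unfolding sum_cube_Suc upd * by (simp add: sum.distrib card_cube sum_distrib_left)
    then show ?case using Suc.IH(1) 1 by (simp add: algebra_simps) }
  { case 2
    then have t: "t * t = 1" by (simp add: t_def)
    have *: "(x + 1 * t) ^ 4 + (x + -1 * t) ^ 4 = 2 * x ^ 4 + 12 * x\<^sup>2 + 2" for x
      using t by algebra
    have "(\<Sum>\<epsilon>\<in>cube (Suc m). cube_inner (Suc m) \<epsilon> \<delta> ^ 4) =
        2 * (\<Sum>\<epsilon>\<in>cube m. cube_inner m \<epsilon> \<delta> ^ 4) + 12 * (\<Sum>\<epsilon>\<in>cube m. (cube_inner m \<epsilon> \<delta>)\<^sup>2) + 2 * 2 ^ m"
      unfolding sum_cube_Suc upd * by (simp add: sum.distrib card_cube sum_distrib_left)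
    then show ?case using Suc.IH 2 by (simp add: algebra_simps power2_eq_square) }
qed

text \<open>The first moment is at least half the standard deviation \<open>k\<close>. It is bounded from below by the second and fourth moments through the
inequality \<open>y \<ge> 3 y\<^sup>2 - 4 y ^ 4\<close>, valid for \<open>y \<ge> 0\<close> because the difference is \<open>y (2 y - 1)\<^sup>2 (y + 1)\<close>. Taking a square as the number of
signs avoids square roots.\<close>

lemma sum_abs_cube_inner_ge:
  assumes "\<And>i. i \<in> {1..k\<^sup>2} \<Longrightarrow> \<delta> i * \<delta> i = 1" "0 < k"
  shows "real k / 2 * 2 ^ (k\<^sup>2) \<le> (\<Sum>\<epsilon>\<in>cube (k\<^sup>2). \<bar>cube_inner (k\<^sup>2) \<epsilon> \<delta>\<bar>)"
proof -
  let ?m = "k\<^sup>2" let ?x = "\<lambda>\<epsilon>. cube_inner ?m \<epsilon> \<delta>"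
  have pt: "3 / (4 * k) * x\<^sup>2 - 1 / (16 * k ^ 3) * x ^ 4 \<le> \<bar>x\<bar>" for x :: real
  proof -
    define y where "y = \<bar>x\<bar> / (4 * k)"
    have "0 \<le> y * ((2 * y - 1)\<^sup>2 * (y + 1))" by (simp add: y_def)
    then have "3 * y\<^sup>2 - 4 * y ^ 4 \<le> y"
      by (simp add: power2_eq_square power4_eq_xxxx algebra_simps)
    then have "4 * k * (3 * y\<^sup>2 - 4 * y ^ 4) \<le> 4 * k * y" by (rule mult_left_mono) simp
    also have "y\<^sup>2 = x\<^sup>2 / (16 * k\<^sup>2)"
      by (simp add: y_def power_divide power_mult_distrib)
    also have "y ^ 4 = x ^ 4 / (256 * k ^ 4)"
      by (simp add: y_def power_divide power_mult_distrib power_even_abs)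
    also have "4 * k * (3 * (x\<^sup>2 / (16 * k\<^sup>2)) - 4 * (x ^ 4 / (256 * k ^ 4))) = 3 / (4 * k) * x\<^sup>2 - 1 / (16 * k ^ 3) * x ^ 4"
      using assms(2) by (simp add: right_diff_distrib power2_eq_square power3_eq_cube power4_eq_xxxx)
    also have "4 * k * y = \<bar>x\<bar>" using assms(2) by (simp add: y_def)
    finally show ?thesis .
  qed
  have "real k / 2 * 2 ^ ?m \<le> (3 / (4 * k) * real ?m - 1 / (16 * k ^ 3) * (3 * (real ?m)\<^sup>2)) * 2 ^ ?m"
    using assms(2) by (intro mult_right_mono) (auto simp: field_simps power2_eq_square power3_eq_cube)
  also have "\<dots> \<le> (3 / (4 * k) * real ?m - 1 / (16 * k ^ 3) * (3 * (real ?m)\<^sup>2 - 2 * real ?m)) * 2 ^ ?m"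
    by (intro mult_right_mono diff_left_mono mult_left_mono) auto
  also have "\<dots> = 3 / (4 * k) * (\<Sum>\<epsilon>\<in>cube ?m. (?x \<epsilon>)\<^sup>2) - 1 / (16 * k ^ 3) * (\<Sum>\<epsilon>\<in>cube ?m. ?x \<epsilon> ^ 4)"
    by (simp only: cube_inner_moments[OF assms(1)] left_diff_distrib mult.assoc)
  also have "\<dots> = (\<Sum>\<epsilon>\<in>cube ?m. 3 / (4 * k) * (?x \<epsilon>)\<^sup>2 - 1 / (16 * k ^ 3) * ?x \<epsilon> ^ 4)"
    by (simp only: sum_subtractf sum_distrib_left)
  also have "\<dots> \<le> (\<Sum>\<epsilon>\<in>cube ?m. \<bar>?x \<epsilon>\<bar>)" by (intro sum_mono pt)
  finally show ?thesis .
qed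

text \<open>If replacing each coefficient by its sign gives a sum of nearly maximal norm, then so does the original sum: the coefficients
differ from \<open>m\<close> times their signs by \<open>m\<close> minus their absolute values, and the triangle inequality is then
nearly sharp. This replaces a norming functional.\<close>

lemma norm_cube_inner_sum_ge:
  fixes v :: "(nat \<Rightarrow> real) \<Rightarrow> 'a::real_normed_vector"
  assumes \<epsilon>: "\<epsilon> \<in> cube m"
  shows "real m * norm (\<Sum>\<delta>\<in>cube m. sign_of (cube_inner m \<epsilon> \<delta>) *\<^sub>R v \<delta>)
           - (\<Sum>\<delta>\<in>cube m. (real m - \<bar>cube_inner m \<epsilon> \<delta>\<bar>) * norm (v \<delta>))
         \<le> norm (\<Sum>\<delta>\<in>cube m. cube_inner m \<epsilon> \<delta> *\<^sub>R v \<delta>)"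
proof -
  let ?c = "\<lambda>\<delta>. cube_inner m \<epsilon> \<delta>"
  have le: "\<bar>?c \<delta>\<bar> \<le> m" if \<delta>: "\<delta> \<in> cube m" for \<delta>
  proof -
    have "\<bar>?c \<delta>\<bar> \<le> (\<Sum>i=1..m. \<bar>\<epsilon> i * \<delta> i\<bar>)" unfolding cube_inner_def by (rule sum_abs)
    also have "\<dots> \<le> (\<Sum>i=1..m. 1)"
      using cubeD[OF \<epsilon>] cubeD[OF \<delta>] by (intro sum_mono) (fastforce simp: abs_mult)
    finally show ?thesis by simp
  qed
  define X where "X = real m *\<^sub>R (\<Sum>\<delta>\<in>cube m. sign_of (?c \<delta>) *\<^sub>R v \<delta>)"
  define Y where "Y = (\<Sum>\<delta>\<in>cube m. (sign_of (?c \<delta>) * (real m - \<bar>?c \<delta>\<bar>)) *\<^sub>R v \<delta>)"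
  have eq: "(\<Sum>\<delta>\<in>cube m. ?c \<delta> *\<^sub>R v \<delta>) = X - Y"
    unfolding X_def Y_def scaleR_sum_right sum_subtractf[symmetric]
    by (intro sum.cong refl) (simp add: right_diff_distrib sign_of_mult_abs scaleR_diff_left mult.commute[of "real m"])
  have X: "norm X = real m * norm (\<Sum>\<delta>\<in>cube m. sign_of (?c \<delta>) *\<^sub>R v \<delta>)"
    by (simp add: X_def)
  have Y: "norm Y \<le> (\<Sum>\<delta>\<in>cube m. (real m - \<bar>?c \<delta>\<bar>) * norm (v \<delta>))"
    unfolding Y_def using le by (intro sum_norm_le) (simp add: abs_mult)
  show ?thesis
    unfolding eq X[symmetric] using Y norm_triangle_ineq2[of X Y] by linarith
qed

text \<open>Each summand on the left is at most the right-hand side with \<open>\<theta> = 1\<close>, divided by \<open>2 ^ m\<close>. If the average were close to that maximum, then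
so would be every summand, so the \<open>v \<delta>\<close> would have almost equal norms and behave like the unit basis of
\<open>\<ell>\<^sub>1\<close> under the sign patterns \<open>sign_of (cube_inner m \<epsilon> \<delta>)\<close>. The Rademacher projection of such a
\<open>v\<close> has mean norm at least of order \<open>sqrt m\<close>, while K-convexity bounds it by \<open>2 K\<close>.

The inequality involves one space of values and \<open>p\<close>-th powers only, so it can be summed over the points of any
finite measure space. In this way it passes to vector-valued Lp spaces with the same \<open>m\<close> and \<open>\<theta>\<close>.\<close>

lemma K_convex_sign_sums:
  assumes "K_convex TYPE('a::real_normed_vector)" and p: "1 < p"
  obtains m \<theta> where "0 < \<theta>" "\<theta> < 1"
    "\<And>v :: (nat \<Rightarrow> real) \<Rightarrow> 'a.
      (\<Sum>\<epsilon>\<in>cube m. norm (\<Sum>\<delta>\<in>cube m. sign_of (cube_inner m \<epsilon> \<delta>) *\<^sub>R v \<delta>) powr p)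
        \<le> \<theta> * (2 ^ m) powr p * (\<Sum>\<delta>\<in>cube m. norm (v \<delta>) powr p)"
proof -
  obtain K where K: "0 \<le> K" and rad: "\<And>m (v :: (nat \<Rightarrow> real) \<Rightarrow> 'a). 1 \<le> m \<Longrightarrow>
      (\<And>\<delta>. \<delta> \<in> cube m \<Longrightarrow> norm (v \<delta>) \<le> 1) \<Longrightarrow>
      (\<Sum>\<epsilon>\<in>cube m. norm (rademacher_proj m v \<epsilon>)) \<le> K * 2 ^ m"
    using K_convex_mean_bound[OF assms(1)] by blast
  define k where "k = nat \<lceil>8 * K + 4\<rceil> + 1"
  have k: "real k > 8 * K + 4" "k > 0" using K unfolding k_def by linarith+
  define m where "m = k\<^sup>2"
  have m: "1 \<le> m" using k by (simp add: m_def Suc_le_eq)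
  define N :: real where "N = 2 ^ m"
  have N: "1 \<le> N" by (simp add: N_def)
  define \<kappa>\<^sub>0 where "\<kappa>\<^sub>0 = 2 powr p - 1 - p"
  have \<kappa>\<^sub>0: "0 < \<kappa>\<^sub>0" using powr_gt_tangent(2)[of p 2] p by (simp add: \<kappa>\<^sub>0_def)
  define \<kappa> where "\<kappa> = min (min (1/2) (1 / m)) (\<kappa>\<^sub>0 / (2 * N * p))"
  have \<kappa>: "0 < \<kappa>" "\<kappa> \<le> 1/2" "m * \<kappa> \<le> 1" "p * N * \<kappa> < \<kappa>\<^sub>0"
  proof -
    show "0 < \<kappa>" "\<kappa> \<le> 1/2" using m N p \<kappa>\<^sub>0 by (auto simp: \<kappa>_def)
    have "\<kappa> \<le> 1 / m" "\<kappa> \<le> \<kappa>\<^sub>0 / (2 * N * p)" by (auto simp: \<kappa>_def)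
    then show "m * \<kappa> \<le> 1" "p * N * \<kappa> < \<kappa>\<^sub>0" using m N p \<kappa>\<^sub>0 by (auto simp: field_simps)
  qed
  define \<theta> where "\<theta> = 1 - \<kappa> / N"
  have \<theta>: "0 < \<theta>" "\<theta> < 1" using \<kappa> N by (auto simp: \<theta>_def field_simps)
  define h :: "((nat \<Rightarrow> real) \<Rightarrow> 'a) \<Rightarrow> (nat \<Rightarrow> real) \<Rightarrow> real"
    where "h v \<epsilon> = norm (\<Sum>\<delta>\<in>cube m. sign_of (cube_inner m \<epsilon> \<delta>) *\<^sub>R v \<delta>)" for v \<epsilon>
  have normalized: "(\<Sum>\<epsilon>\<in>cube m. h v \<epsilon> powr p) \<le> \<theta> * N powr p * N"
    if v: "(\<Sum>\<delta>\<in>cube m. norm (v \<delta>) powr p) = N" for v :: "(nat \<Rightarrow> real) \<Rightarrow> 'a"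
  proof (rule ccontr)
    assume "\<not> ?thesis"
    then have big: "\<theta> * N * N powr p < (\<Sum>\<epsilon>\<in>cube m. h v \<epsilon> powr p)" by (simp add: mult_ac)
    define g where "g \<delta> = norm (v \<delta>)" for \<delta>
    define \<mu> where "\<mu> = (\<Sum>\<delta>\<in>cube m. g \<delta>) / N"
    have cardN: "real (card (cube m)) = N" by (simp add: card_cube N_def)
    have sumg: "(\<Sum>\<delta>\<in>cube m. g \<delta>) = N * \<mu>" using N by (simp add: \<mu>_def)
    have excess: "(\<Sum>\<delta>\<in>cube m. g \<delta> powr p - 1 - p * (g \<delta> - 1)) = p * N * (1 - \<mu>)"
      using v unfolding sum_subtractf sum_distrib_left[symmetric] g_def[symmetric] sumg
      by (simp add: cardN algebra_simps)
    have excess_nonneg: "0 \<le> g \<delta> powr p - 1 - p * (g \<delta> - 1)" for \<delta>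
      using powr_ge_tangent[of p "g \<delta>"] p by (simp add: g_def)
    have \<mu>1: "\<mu> \<le> 1"
    proof -
      have "0 \<le> p * N * (1 - \<mu>)" unfolding excess[symmetric] by (intro sum_nonneg excess_nonneg)
      moreover have "0 < p * N" using p N by simp
      ultimately show ?thesis by (simp add: zero_le_mult_iff)
    qed
    have hle: "h v \<epsilon> \<le> N * \<mu>" for \<epsilon>
      unfolding h_def sumg[symmetric] by (intro sum_norm_le) (simp add: g_def)
    have h1: "h v \<epsilon> / N \<le> 1" "0 \<le> h v \<epsilon> / N" for \<epsilon>
    proof -
      have "N * \<mu> \<le> N * 1" using \<mu>1 N by (intro mult_left_mono) auto
      then show "h v \<epsilon> / N \<le> 1" using order_trans[OF hle[of \<epsilon>]] N by simp
      show "0 \<le> h v \<epsilon> / N" using N by (simp add: h_def)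
    qed
    have hge: "1 - \<kappa> < h v \<epsilon> / N" if \<epsilon>: "\<epsilon> \<in> cube m" for \<epsilon>
    proof -
      have "N - \<kappa> = \<theta> * N" using N by (simp add: \<theta>_def field_simps)
      also have "\<dots> < (\<Sum>\<epsilon>\<in>cube m. (h v \<epsilon> / N) powr p)"
        using big N by (simp add: powr_divide h_def pos_less_divide_eq flip: sum_divide_distrib)
      also have "\<dots> = (h v \<epsilon> / N) powr p + (\<Sum>\<epsilon>\<in>cube m - {\<epsilon>}. (h v \<epsilon> / N) powr p)"
        using \<epsilon> by (intro sum.remove) auto
      also have "(\<Sum>\<epsilon>\<in>cube m - {\<epsilon>}. (h v \<epsilon> / N) powr p) \<le> (\<Sum>\<epsilon>\<in>cube m - {\<epsilon>}. 1)"
        using h1 p N by (intro sum_mono powr_le1) (auto simp: h_def)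
      also have "\<dots> = N - 1" using \<epsilon> N by (simp add: card_Diff_singleton card_cube N_def of_nat_diff)
      finally have "1 - \<kappa> < (h v \<epsilon> / N) powr p" by simp
      also have "\<dots> \<le> (h v \<epsilon> / N) powr 1" by (rule powr_mono') (use h1 p in auto)
      also have "(h v \<epsilon> / N) powr 1 = h v \<epsilon> / N" by (rule powr_one[OF h1(2)])
      finally show ?thesis .
    qed
    obtain \<epsilon>\<^sub>0 where "\<epsilon>\<^sub>0 \<in> cube m" using cube_nonempty by blast
    with hge hle[of \<epsilon>\<^sub>0] have \<mu>2: "1 - \<kappa> \<le> \<mu>" using N by (smt (verit) divide_le_eq mult.commute)
    have g2: "g \<delta> \<le> 2" if "\<delta> \<in> cube m" for \<delta>
    proof (rule ccontr)
      assume "\<not> g \<delta> \<le> 2"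
      then have "\<kappa>\<^sub>0 \<le> g \<delta> powr p - 1 - p * (g \<delta> - 1)"
        unfolding \<kappa>\<^sub>0_def using p by (intro powr_gt_tangent(1)) auto
      also have "\<dots> \<le> (\<Sum>\<delta>\<in>cube m. g \<delta> powr p - 1 - p * (g \<delta> - 1))"
        using that excess_nonneg by (intro member_le_sum) auto
      also have "\<dots> \<le> p * N * \<kappa>" unfolding excess using \<mu>2 p N by (intro mult_left_mono) auto
      finally show False using \<kappa> by simp
    qed
    define A where "A \<epsilon> = norm (\<Sum>\<delta>\<in>cube m. cube_inner m \<epsilon> \<delta> *\<^sub>R v \<delta>)" for \<epsilon>
    have "(\<Sum>\<epsilon>\<in>cube m. norm (rademacher_proj m (\<lambda>\<delta>. (1/2) *\<^sub>R v \<delta>) \<epsilon>)) \<le> K * 2 ^ m"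
      using g2 by (intro rad m) (auto simp: g_def)
    moreover have "norm (rademacher_proj m (\<lambda>\<delta>. (1/2) *\<^sub>R v \<delta>) \<epsilon>) = A \<epsilon> / (2 * N)" for \<epsilon>
    proof -
      have "rademacher_proj m (\<lambda>\<delta>. (1/2) *\<^sub>R v \<delta>) \<epsilon> = (1 / (2 * N)) *\<^sub>R (\<Sum>\<delta>\<in>cube m. cube_inner m \<epsilon> \<delta> *\<^sub>R v \<delta>)"
        by (simp add: rademacher_proj_eq_cube_inner N_def scaleR_sum_right mult_ac)
      then show ?thesis using N by (simp add: A_def)
    qed
    ultimately have up: "(\<Sum>\<epsilon>\<in>cube m. A \<epsilon>) \<le> 2 * K * N * N"
      using N by (simp add: N_def[symmetric] field_simps flip: sum_divide_distrib)
    have "N * (N * (real k / 2 * \<mu> - m * \<kappa>)) \<le> N * (m * (N * (1 - \<kappa>)) - m * (N * \<mu>)) + (\<Sum>\<delta>\<in>cube m. real k / 2 * N * g \<delta>)"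
    proof -
      have "(\<Sum>\<delta>\<in>cube m. real k / 2 * N * g \<delta>) = real k / 2 * N * (N * \<mu>)"
        by (simp only: sum_distrib_left[symmetric] sumg)
      moreover have "N * (m * (N * (1 - \<kappa>)) - m * (N * 1)) \<le> N * (m * (N * (1 - \<kappa>)) - m * (N * \<mu>))"
        using \<mu>1 N by (intro mult_left_mono diff_left_mono) auto
      ultimately show ?thesis by (simp add: algebra_simps)
    qed
    also have "(\<Sum>\<delta>\<in>cube m. real k / 2 * N * g \<delta>) \<le> (\<Sum>\<delta>\<in>cube m. (\<Sum>\<epsilon>\<in>cube m. \<bar>cube_inner m \<epsilon> \<delta>\<bar>) * g \<delta>)"
      unfolding N_def m_def using k cube_square
      by (intro sum_mono mult_right_mono sum_abs_cube_inner_ge) (auto simp: g_def)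
    also have "\<dots> = (\<Sum>\<epsilon>\<in>cube m. \<Sum>\<delta>\<in>cube m. \<bar>cube_inner m \<epsilon> \<delta>\<bar> * g \<delta>)"
      unfolding sum_distrib_right by (rule sum.swap)
    also have "N * (m * (N * (1 - \<kappa>)) - m * (N * \<mu>)) + (\<Sum>\<epsilon>\<in>cube m. \<Sum>\<delta>\<in>cube m. \<bar>cube_inner m \<epsilon> \<delta>\<bar> * g \<delta>)
        = (\<Sum>\<epsilon>\<in>cube m. m * (N * (1 - \<kappa>)) - m * (N * \<mu>) + (\<Sum>\<delta>\<in>cube m. \<bar>cube_inner m \<epsilon> \<delta>\<bar> * g \<delta>))"
      by (simp add: sum.distrib cardN)
    also have "\<dots> \<le> (\<Sum>\<epsilon>\<in>cube m. A \<epsilon>)"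
    proof (rule sum_mono)
      fix \<epsilon> assume \<epsilon>: "\<epsilon> \<in> cube m"
      have "N * (1 - \<kappa>) \<le> h v \<epsilon>" using hge[OF \<epsilon>] N by (simp add: field_simps)
      then have "m * (N * (1 - \<kappa>)) \<le> m * h v \<epsilon>" by (rule mult_left_mono) simp
      moreover have "(\<Sum>\<delta>\<in>cube m. (real m - \<bar>cube_inner m \<epsilon> \<delta>\<bar>) * g \<delta>) = m * (N * \<mu>) - (\<Sum>\<delta>\<in>cube m. \<bar>cube_inner m \<epsilon> \<delta>\<bar> * g \<delta>)"
        by (simp add: left_diff_distrib sum_subtractf sumg flip: sum_distrib_left)
      ultimately show "m * (N * (1 - \<kappa>)) - m * (N * \<mu>) + (\<Sum>\<delta>\<in>cube m. \<bar>cube_inner m \<epsilon> \<delta>\<bar> * g \<delta>) \<le> A \<epsilon>"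
        using norm_cube_inner_sum_ge[OF \<epsilon>, of v] unfolding A_def h_def g_def by linarith
    qed
    finally have "N * (N * (real k / 2 * \<mu> - m * \<kappa>)) \<le> N * (N * (2 * K))" using up by (simp add: mult_ac)
    then have "real k / 2 * \<mu> - m * \<kappa> \<le> 2 * K" using N by simp
    moreover have "real k / 2 * (1/2) \<le> real k / 2 * \<mu>" using \<mu>2 \<kappa> by (intro mult_left_mono) auto
    ultimately show False using k \<kappa> by linarith
  qed
  show thesis
  proof
    show "0 < \<theta>" "\<theta> < 1" by fact+
    fix v :: "(nat \<Rightarrow> real) \<Rightarrow> 'a"
    define T where "T = (\<Sum>\<delta>\<in>cube m. norm (v \<delta>) powr p)"
    have T: "0 \<le> T" unfolding T_def by (intro sum_nonneg) auto
    have "(\<Sum>\<epsilon>\<in>cube m. h v \<epsilon> powr p) \<le> \<theta> * N powr p * T"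
    proof (cases "T = 0")
      case True
      then have "\<forall>\<delta>\<in>cube m. v \<delta> = 0"
        unfolding T_def by (subst (asm) sum_nonneg_eq_0_iff) auto
      then show ?thesis using p by (simp add: h_def True)
    next
      case False
      with T have "T > 0" by simp
      define s where "s = (N / T) powr (1 / p)"
      have s: "0 < s" "s powr p = N / T" using N \<open>T > 0\<close> p by (auto simp: s_def powr_powr)
      have "(\<Sum>\<delta>\<in>cube m. norm (s *\<^sub>R v \<delta>) powr p) = s powr p * T"
        using s(1) by (simp add: T_def powr_mult sum_distrib_left)
      also have "\<dots> = N" using s \<open>T > 0\<close> by simp
      finally have "(\<Sum>\<epsilon>\<in>cube m. h (\<lambda>\<delta>. s *\<^sub>R v \<delta>) \<epsilon> powr p) \<le> \<theta> * N powr p * N"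
        by (rule normalized)
      moreover have "h (\<lambda>\<delta>. s *\<^sub>R v \<delta>) \<epsilon> = s * h v \<epsilon>" for \<epsilon>
      proof -
        have "(\<Sum>\<delta>\<in>cube m. sign_of (cube_inner m \<epsilon> \<delta>) *\<^sub>R s *\<^sub>R v \<delta>) = s *\<^sub>R (\<Sum>\<delta>\<in>cube m. sign_of (cube_inner m \<epsilon> \<delta>) *\<^sub>R v \<delta>)"
          by (simp add: scaleR_sum_right mult.commute)
        then show ?thesis using s(1) by (simp add: h_def)
      qed
      ultimately have "N / T * (\<Sum>\<epsilon>\<in>cube m. h v \<epsilon> powr p) \<le> \<theta> * N powr p * N"
        using s(1) by (simp add: powr_mult h_def s(2)[symmetric] sum_distrib_left)
      then show ?thesis using N \<open>T > 0\<close> by (simp add: field_simps)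
    qed
    then show "(\<Sum>\<epsilon>\<in>cube m. norm (\<Sum>\<delta>\<in>cube m. sign_of (cube_inner m \<epsilon> \<delta>) *\<^sub>R v \<delta>) powr p)
        \<le> \<theta> * (2 ^ m) powr p * (\<Sum>\<delta>\<in>cube m. norm (v \<delta>) powr p)"
      by (simp add: h_def N_def T_def)
  qed
qed

section \<open>A maximum principle for seminorms of coefficient sequences\<close>

text \<open>The mean over the points \<open>z0 \<plusminus> r\<close> and \<open>z0 \<plusminus> \<i> r\<close> cancels the Taylor terms of first and second order. It serves as a
discrete mean value property, so that no vector-valued integral is needed.\<close>

lemma four_point_mean:
  assumes "\<phi> holomorphic_on G" "open G" "z0 \<in> G"
  shows "\<exists>C r0. 0 < r0 \<and> 0 \<le> C \<and> cball z0 r0 \<subseteq> G \<and>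
     (\<forall>r. 0 \<le> r \<and> r \<le> r0 \<longrightarrow>
      cmod (\<phi> (z0 + r) + \<phi> (z0 - r) + \<phi> (z0 + \<i> * r) + \<phi> (z0 - \<i> * r) - 4 * \<phi> z0) \<le> C * r ^ 3)"
proof -
  obtain r0 where r0: "0 < r0" "cball z0 r0 \<subseteq> G"
    using assms open_contains_cball by blast
  define f where "f i = (deriv ^^ i) \<phi>" for i
  have hol: "f i holomorphic_on G" for i
    unfolding f_def by (intro holomorphic_higher_deriv assms)
  have "compact (f 3 ` cball z0 r0)"
    using hol[of 3] r0 by (intro compact_continuous_image holomorphic_on_imp_continuous_on)
       (auto intro: holomorphic_on_subset)
  then obtain B where B: "\<And>x. x \<in> cball z0 r0 \<Longrightarrow> cmod (f 3 x) \<le> B"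
    by (metis compact_imp_bounded bounded_iff imageI)
  have "0 \<le> B" using B[of z0] r0(1) by (meson centre_in_cball less_imp_le norm_ge_zero order_trans)
  have T: "cmod (\<phi> z - (\<phi> z0 + f 1 z0 * (z - z0) + f 2 z0 * (z - z0)\<^sup>2 / 2)) \<le> B * cmod (z - z0) ^ 3 / 2"
    if "z \<in> cball z0 r0" for z
  proof -
    have "cmod (f 0 z - (\<Sum>i\<le>2. f i z0 * (z - z0) ^ i / fact i)) \<le> B * cmod (z - z0) ^ Suc 2 / fact 2"
    proof (rule complex_Taylor)
      fix i x assume x: "x \<in> cball z0 r0"
      have "f i field_differentiable at x"
        using hol[of i] x r0 assms by (metis holomorphic_on_imp_differentiable_at subsetD)
      then show "(f i has_field_derivative f (Suc i) x) (at x within cball z0 r0)"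
        by (simp add: f_def DERIV_deriv_iff_field_differentiable has_field_derivative_at_within)
    qed (use B that r0 in \<open>auto simp: numeral_3_eq_3\<close>)
    then show ?thesis by (simp add: f_def numeral_2_eq_2 numeral_3_eq_3 add.assoc)
  qed
  show ?thesis
  proof (intro exI conjI allI impI)
    show "0 < r0" "cball z0 r0 \<subseteq> G" by fact+
    show "0 \<le> 2 * B" using \<open>0 \<le> B\<close> by simp
    fix r :: real assume r: "0 \<le> r \<and> r \<le> r0"
    define R where "R z = \<phi> z - (\<phi> z0 + f 1 z0 * (z - z0) + f 2 z0 * (z - z0)\<^sup>2 / 2)" for z
    have R: "cmod (R (z0 + h)) \<le> B * r ^ 3 / 2" if "cmod h = r" for h
      using T[of "z0 + h"] that r by (auto simp: R_def dist_norm)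
    have "\<phi> (z0 + r) + \<phi> (z0 - r) + \<phi> (z0 + \<i> * r) + \<phi> (z0 - \<i> * r) - 4 * \<phi> z0
       = R (z0 + r) + R (z0 + - r) + R (z0 + \<i> * r) + R (z0 + - (\<i> * r))"
      by (simp add: R_def power2_eq_square algebra_simps)
    also have "cmod \<dots> \<le> B * r ^ 3 / 2 + B * r ^ 3 / 2 + B * r ^ 3 / 2 + B * r ^ 3 / 2"
      by (intro norm_triangle_le add_mono R) (use r in \<open>auto simp: norm_mult\<close>)
    finally show "cmod (\<phi> (z0 + r) + \<phi> (z0 - r) + \<phi> (z0 + \<i> * r) + \<phi> (z0 - \<i> * r) - 4 * \<phi> z0) \<le> 2 * B * r ^ 3"
      by simp
  qed
qed

text \<open>The intended seminorm is \<open>a \<mapsto> \<parallel>a\<^sub>0 f\<^sub>0 + \<dots> + a\<^sub>d f\<^sub>d\<parallel>\<close>. Working with coefficient sequences turns Fourier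
multipliers into pointwise products and makes all holomorphic functions scalar-valued.\<close>

locale coeff_seminorm =
  fixes \<Phi> :: "(nat \<Rightarrow> complex) \<Rightarrow> real" and d :: nat
  assumes triangle: "\<Phi> (\<lambda>k. a k + b k) \<le> \<Phi> a + \<Phi> b"
    and homogeneous: "\<Phi> (\<lambda>k. z * a k) = cmod z * \<Phi> a"
    and cutoff: "(\<And>k. k \<le> d \<Longrightarrow> a k = b k) \<Longrightarrow> \<Phi> a = \<Phi> b"
begin

lemma zero [simp]: "\<Phi> (\<lambda>k. 0) = 0"
  using homogeneous[of 0 "\<lambda>k. 0"] by simp

lemma uminus: "\<Phi> (\<lambda>k. - a k) = \<Phi> a"
  using homogeneous[of "-1" a] by simp

lemma nonneg: "0 \<le> \<Phi> a"
  using triangle[of a "\<lambda>k. - a k"] by (simp add: uminus)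

lemma triangle_diff: "\<Phi> (\<lambda>k. a k - b k) \<le> \<Phi> a + \<Phi> b"
  using triangle[of a "\<lambda>k. - b k"] by (simp add: uminus)

lemma triangle_sub: "\<Phi> a - \<Phi> b \<le> \<Phi> (\<lambda>k. a k - b k)"
  using triangle[of "\<lambda>k. a k - b k" b] by simp

lemma triangle_sum: "finite I \<Longrightarrow> \<Phi> (\<lambda>k. \<Sum>i\<in>I. f i k) \<le> (\<Sum>i\<in>I. \<Phi> (f i))"
proof (induction I rule: finite_induct)
  case (insert i I)
  then show ?case using triangle[of "f i" "\<lambda>k. \<Sum>i\<in>I. f i k"] by simp
qed simp

definition coord :: "nat \<Rightarrow> nat \<Rightarrow> complex" where
  "coord j k = (if k = j then 1 else 0)"

lemma le_sum_coords: "\<Phi> a \<le> (\<Sum>j\<le>d. cmod (a j) * \<Phi> (coord j))"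
proof -
  have "\<Phi> a = \<Phi> (\<lambda>k. \<Sum>j\<in>{..d}. a j * coord j k)"
    by (rule cutoff) (simp add: coord_def if_distrib cong: if_cong)
  also have "\<dots> \<le> (\<Sum>j\<le>d. \<Phi> (\<lambda>k. a j * coord j k))"
    by (rule triangle_sum) simp
  finally show ?thesis by (simp add: homogeneous)
qed

lemma tendsto_seminorm:
  assumes "\<And>k. k \<le> d \<Longrightarrow> ((\<lambda>x. a x k) \<longlongrightarrow> b k) F"
  shows "((\<lambda>x. \<Phi> (a x)) \<longlongrightarrow> \<Phi> b) F"
proof (rule Lim_null_comparison[THEN LIM_zero_cancel])
  have "\<bar>\<Phi> (a x) - \<Phi> b\<bar> \<le> (\<Sum>j\<le>d. cmod (a x j - b j) * \<Phi> (coord j))" for x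
    using triangle_sub[of "a x" b] triangle_sub[of b "a x"] uminus[of "\<lambda>k. a x k - b k"]
      le_sum_coords[of "\<lambda>k. a x k - b k"] by (simp add: abs_le_iff)
  then show "\<forall>\<^sub>F x in F. norm (\<Phi> (a x) - \<Phi> b) \<le> (\<Sum>j\<le>d. cmod (a x j - b j) * \<Phi> (coord j))"
    by simp
  have "((\<lambda>x. \<Sum>j\<le>d. cmod (a x j - b j) * \<Phi> (coord j)) \<longlongrightarrow> (\<Sum>j\<le>d. 0 * \<Phi> (coord j))) F"
    by (intro tendsto_sum tendsto_mult tendsto_const tendsto_norm_zero LIM_zero) (use assms in auto)
  then show "((\<lambda>x. \<Sum>j\<le>d. cmod (a x j - b j) * \<Phi> (coord j)) \<longlongrightarrow> 0) F" by simp
qed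

lemma continuous_on_seminorm:
  assumes "\<And>k. k \<le> d \<Longrightarrow> continuous_on S (\<lambda>z. F z k)"
  shows "continuous_on S (\<lambda>z. \<Phi> (F z))"
  using assms unfolding continuous_on_def by (auto intro!: tendsto_seminorm)

text \<open>A seminorm of a holomorphic function is subharmonic. Adding \<open>\<eta> \<bar>z\<bar>\<^sup>2\<close> makes it strictly so: at an interior maximum, the
four-point mean of the sum would exceed its value at the centre by \<open>\<eta> r\<^sup>2 - O(r\<^sup>3)\<close>.\<close>

lemma maximum_principle:
  fixes F :: "complex \<Rightarrow> nat \<Rightarrow> complex"
  assumes G: "open G" "bounded G"
    and hol: "\<And>k. k \<le> d \<Longrightarrow> (\<lambda>z. F z k) holomorphic_on G"
    and cont: "\<And>k. k \<le> d \<Longrightarrow> continuous_on (closure G) (\<lambda>z. F z k)"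
    and bd: "\<And>z. z \<in> frontier G \<Longrightarrow> \<Phi> (F z) \<le> B"
    and z: "z \<in> G"
  shows "\<Phi> (F z) \<le> B"
proof (rule ccontr)
  assume "\<not> \<Phi> (F z) \<le> B"
  obtain R where R: "R > 0" "\<And>z. z \<in> closure G \<Longrightarrow> cmod z \<le> R"
    using bounded_closure[OF G(2)] unfolding bounded_pos by blast
  define \<eta> where "\<eta> = (\<Phi> (F z) - B) / (2 * R\<^sup>2)"
  have \<eta>: "\<eta> > 0" "\<eta> * R\<^sup>2 < \<Phi> (F z) - B"
    using R(1) \<open>\<not> \<Phi> (F z) \<le> B\<close> by (auto simp: \<eta>_def field_simps)
  \<comment> \<open>\<open>\<eta>\<close> is so small that the added term cannot move the maximum to the boundary.\<close>
  define g where "g z = \<Phi> (F z) + \<eta> * (cmod z)\<^sup>2" for z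
  have "continuous_on (closure G) g"
    unfolding g_def by (intro continuous_intros continuous_on_seminorm cont)
  moreover have "compact (closure G)" using G(2) by (simp add: compact_closure)
  moreover have zG: "z \<in> closure G" using z closure_subset by blast
  ultimately have "\<exists>x\<in>closure G. \<forall>y\<in>closure G. g y \<le> g x"
    by (intro continuous_attains_sup) auto
  then obtain z0 where z0: "z0 \<in> closure G" "\<And>y. y \<in> closure G \<Longrightarrow> g y \<le> g z0"
    by blast
  have "z0 \<notin> frontier G"
  proof
    assume "z0 \<in> frontier G"
    then have "g z0 \<le> B + \<eta> * R\<^sup>2"
      unfolding g_def using bd R(2)[OF z0(1)] \<eta>(1) by (intro add_mono mult_left_mono power_mono) auto
    also have "\<dots> < \<Phi> (F z)" using \<eta> by simp
    also have "\<dots> \<le> g z" using \<eta> by (simp add: g_def)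
    finally show False using z0(2)[of z] zG by simp
  qed
  then have z0G: "z0 \<in> G" using z0(1) G(1) by (simp add: frontier_def interior_open)
  have "\<forall>k\<in>{..d}. \<exists>C r0. 0 < r0 \<and> 0 \<le> C \<and> cball z0 r0 \<subseteq> G \<and>
     (\<forall>r. 0 \<le> r \<and> r \<le> r0 \<longrightarrow>
      cmod (F (z0 + r) k + F (z0 - r) k + F (z0 + \<i> * r) k + F (z0 - \<i> * r) k - 4 * F z0 k) \<le> C * r ^ 3)"
    using four_point_mean[OF hol G(1) z0G] by (auto simp: atMost_def)
  from bchoice[OF this] obtain C where "\<forall>k\<in>{..d}. \<exists>r0. 0 < r0 \<and> 0 \<le> C k \<and> cball z0 r0 \<subseteq> G \<and>
     (\<forall>r. 0 \<le> r \<and> r \<le> r0 \<longrightarrow>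
      cmod (F (z0 + r) k + F (z0 - r) k + F (z0 + \<i> * r) k + F (z0 - \<i> * r) k - 4 * F z0 k) \<le> C k * r ^ 3)"
    by blast
  from bchoice[OF this] obtain r0 where C: "\<forall>k\<in>{..d}. 0 < r0 k \<and> 0 \<le> C k \<and> cball z0 (r0 k) \<subseteq> G \<and>
     (\<forall>r. 0 \<le> r \<and> r \<le> r0 k \<longrightarrow>
      cmod (F (z0 + r) k + F (z0 - r) k + F (z0 + \<i> * r) k + F (z0 - \<i> * r) k - 4 * F z0 k) \<le> C k * r ^ 3)"
    by blast
  define D where "D = (\<Sum>k\<le>d. C k * \<Phi> (coord k))"
  have "D \<ge> 0" unfolding D_def using C nonneg by (auto intro!: sum_nonneg)
  define \<rho> where "\<rho> = Min (r0 ` {..d})"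
  have \<rho>: "\<rho> > 0" "\<And>k. k \<le> d \<Longrightarrow> \<rho> \<le> r0 k" unfolding \<rho>_def using C by auto
  define r where "r = min \<rho> (\<eta> / (D + 1))"
  have r: "0 < r" "r \<le> \<rho>" "r * D < 4 * \<eta>"
  proof -
    show "0 < r" "r \<le> \<rho>" using \<rho> \<eta> \<open>D \<ge> 0\<close> by (auto simp: r_def)
    have "r * D \<le> \<eta> / (D + 1) * D" using \<open>D \<ge> 0\<close> by (intro mult_right_mono) (auto simp: r_def)
    also have "\<dots> \<le> \<eta>" using \<open>D \<ge> 0\<close> \<eta>(1) by (simp add: field_simps)
    also have "\<dots> < 4 * \<eta>" using \<eta>(1) by simp
    finally show "r * D < 4 * \<eta>" .
  qed
  define P where "P = (\<lambda>h. z0 + h * complex_of_real r)"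
  have PG: "P h \<in> closure G" if "cmod h = 1" for h
    using that bspec[OF C, of 0] \<rho>(2)[of 0] r closure_subset[of G]
    by (auto simp: P_def subset_iff dist_norm norm_mult)
  have "4 * F z0 k = (F (P 1) k + F (P (-1)) k + F (P \<i>) k + F (P (-\<i>)) k) -
      (F (P 1) k + F (P (-1)) k + F (P \<i>) k + F (P (-\<i>)) k - 4 * F z0 k)" for k by simp
  then have "4 * \<Phi> (F z0) = \<Phi> (\<lambda>k. (F (P 1) k + F (P (-1)) k + F (P \<i>) k + F (P (-\<i>)) k) -
      (F (P 1) k + F (P (-1)) k + F (P \<i>) k + F (P (-\<i>)) k - 4 * F z0 k))"
    using homogeneous[of 4 "F z0"] by simp
  also have "\<dots> \<le> \<Phi> (\<lambda>k. F (P 1) k + F (P (-1)) k + F (P \<i>) k + F (P (-\<i>)) k) +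
      \<Phi> (\<lambda>k. F (P 1) k + F (P (-1)) k + F (P \<i>) k + F (P (-\<i>)) k - 4 * F z0 k)"
    by (rule triangle_diff)
  also have "\<Phi> (\<lambda>k. F (P 1) k + F (P (-1)) k + F (P \<i>) k + F (P (-\<i>)) k)
     \<le> \<Phi> (F (P 1)) + \<Phi> (F (P (-1))) + \<Phi> (F (P \<i>)) + \<Phi> (F (P (-\<i>)))"
    by (intro order_trans[OF triangle] add_mono order_refl)
  also have "\<Phi> (\<lambda>k. F (P 1) k + F (P (-1)) k + F (P \<i>) k + F (P (-\<i>)) k - 4 * F z0 k) \<le> r ^ 3 * D"
  proof -
    have "cmod (F (P 1) k + F (P (-1)) k + F (P \<i>) k + F (P (-\<i>)) k - 4 * F z0 k) \<le> C k * r ^ 3" if "k \<le> d" for k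
      using bspec[OF C, of k] that r \<rho>(2)[OF that] by (simp add: P_def)
    then show ?thesis unfolding D_def sum_distrib_left
      by (intro order_trans[OF le_sum_coords] sum_mono)
         (auto intro!: mult_right_mono nonneg simp flip: mult.assoc simp: mult.commute[of "r ^ 3"])
  qed
  finally have 1: "4 * \<Phi> (F z0) \<le> \<Phi> (F (P 1)) + \<Phi> (F (P (-1))) + \<Phi> (F (P \<i>)) + \<Phi> (F (P (-\<i>))) + r ^ 3 * D"
    by simp
  have sq: "(cmod (P 1))\<^sup>2 + (cmod (P (-1)))\<^sup>2 + (cmod (P \<i>))\<^sup>2 + (cmod (P (-\<i>)))\<^sup>2 = 4 * (cmod z0)\<^sup>2 + 4 * r\<^sup>2"
    unfolding cmod_power2 by (simp add: P_def power2_eq_square algebra_simps)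
  have "g (P 1) + g (P (-1)) + g (P \<i>) + g (P (-\<i>)) =
     \<Phi> (F (P 1)) + \<Phi> (F (P (-1))) + \<Phi> (F (P \<i>)) + \<Phi> (F (P (-\<i>))) + \<eta> * (4 * (cmod z0)\<^sup>2 + 4 * r\<^sup>2)"
    unfolding sq[symmetric] g_def by (simp only: distrib_left add_ac)
  moreover have "4 * \<Phi> (F z0) - r ^ 3 * D + \<eta> * (4 * (cmod z0)\<^sup>2 + 4 * r\<^sup>2) = 4 * g z0 + r\<^sup>2 * (4 * \<eta> - r * D)"
    by (simp add: g_def algebra_simps power2_eq_square power3_eq_cube)
  moreover have "0 < r\<^sup>2 * (4 * \<eta> - r * D)" using r by simp
  ultimately have "g (P 1) + g (P (-1)) + g (P \<i>) + g (P (-\<i>)) > 4 * g z0"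
    using 1 by linarith
  moreover have "g (P 1) \<le> g z0" "g (P (-1)) \<le> g z0" "g (P \<i>) \<le> g z0" "g (P (-\<i>)) \<le> g z0"
    by (auto intro!: z0(2) PG)
  ultimately show False by linarith
qed

end

section \<open>Resolvent bounds from the noise operator\<close>

lemma tendsto_exp_diff_quotient:
  fixes z :: complex
  shows "(\<lambda>m. of_nat m * (exp (z / of_nat m) - 1)) \<longlonglongrightarrow> z"
proof (cases "z = 0")
  case False
  have "((\<lambda>h::complex. (exp h - 1) / h) \<longlongrightarrow> 1) (at 0)"
    using DERIV_exp[of "0::complex"] by (simp add: has_field_derivative_iff)
  moreover have "filterlim (\<lambda>m. z / of_nat m) (at 0) sequentially"
    unfolding filterlim_at
  proof
    show "\<forall>\<^sub>F m in sequentially. z / of_nat m \<in> UNIV \<and> z / of_nat m \<noteq> 0"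
      using eventually_gt_at_top[of "0::nat"] by eventually_elim (use False in auto)
    show "(\<lambda>m. z / of_nat m) \<longlonglongrightarrow> 0"
      using tendsto_mult_right_zero[OF lim_inverse_n, of z] by (simp add: divide_inverse)
  qed
  ultimately have "(\<lambda>m. (exp (z / of_nat m) - 1) / (z / of_nat m)) \<longlonglongrightarrow> 1"
    by (rule filterlim_compose)
  from tendsto_mult_left[OF this, of z]
  have "(\<lambda>m. z * ((exp (z / of_nat m) - 1) / (z / of_nat m))) \<longlonglongrightarrow> z" by simp
  then show ?thesis
  proof (rule Lim_transform_eventually)
    show "\<forall>\<^sub>F m in sequentially. z * ((exp (z / of_nat m) - 1) / (z / of_nat m)) = of_nat m * (exp (z / of_nat m) - 1)"
      using eventually_gt_at_top[of "0::nat"] by eventually_elim (use False in \<open>simp add: field_simps\<close>)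
  qed
qed auto

text \<open>The noise operator multiplies the \<open>k\<close>-th coefficient by \<open>\<rho> ^ k\<close>. For a contraction, \<open>(1 - T) ^ N\<close> has norm at most
\<open>2 ^ N\<close>; the assumption is that this is improved by a factor \<open>q < 1\<close>, uniformly in \<open>\<rho>\<close>.\<close>

locale noise_seminorm = coeff_seminorm +
  fixes N :: nat and q :: real
  assumes q: "0 \<le> q" "q < 1" and N: "1 \<le> N"
    and noise_le: "0 \<le> \<rho> \<Longrightarrow> \<rho> \<le> 1 \<Longrightarrow> \<Phi> (\<lambda>k. of_real \<rho> ^ k * a k) \<le> \<Phi> a"
    and power_gap: "0 \<le> \<rho> \<Longrightarrow> \<rho> \<le> 1 \<Longrightarrow>
      \<Phi> (\<lambda>k. (1 - of_real \<rho> ^ k) ^ N * a k) \<le> q * 2 ^ N * \<Phi> a"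

text \<open>The factor \<open>N / (2 (1 - q))\<close> bounds the inverse of \<open>1 + T\<close>, and Kato's argument costs a factor \<open>pi\<close>; a value below
\<open>1\<close> would be wrong at \<open>w = 0\<close>.\<close>

definition resolvent_bound :: "nat \<Rightarrow> real \<Rightarrow> real" where
  "resolvent_bound N q = max 1 (pi * (N / (2 * (1 - q))))"

context noise_seminorm
begin

lemma noise_power_le:
  assumes "0 \<le> \<rho>" "\<rho> \<le> 1"
  shows "\<Phi> (\<lambda>k. (of_real \<rho> ^ k) ^ j * a k) \<le> \<Phi> a"
proof -
  have "(of_real \<rho> ^ k) ^ j = complex_of_real (\<rho> ^ j) ^ k" for k
    by (simp add: mult.commute flip: power_mult)
  then show ?thesis using noise_le[of "\<rho> ^ j" a] assms by (simp add: power_le_one)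
qed

lemma one_minus_noise_power_le:
  assumes "0 \<le> \<rho>" "\<rho> \<le> 1"
  shows "\<Phi> (\<lambda>k. (1 - of_real \<rho> ^ k) ^ j * a k) \<le> 2 ^ j * \<Phi> a"
proof (induction j)
  case (Suc j)
  let ?b = "\<lambda>k. (1 - of_real \<rho> ^ k) ^ j * a k"
  have "\<Phi> (\<lambda>k. (1 - of_real \<rho> ^ k) ^ Suc j * a k) = \<Phi> (\<lambda>k. ?b k - of_real \<rho> ^ k * ?b k)"
    by (simp add: algebra_simps)
  also have "\<dots> \<le> \<Phi> ?b + \<Phi> ?b"
    using triangle_diff[of ?b "\<lambda>k. of_real \<rho> ^ k * ?b k"] noise_le[OF assms, of ?b] by linarith
  finally show ?case using Suc by simp
qed simp

text \<open>\<open>1 + T\<close> divides \<open>2 ^ N - (1 - T) ^ N\<close>, which is bounded below by \<open>2 ^ N (1 - q)\<close>.\<close>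

lemma le_one_plus_noise:
  assumes "0 \<le> \<rho>" "\<rho> \<le> 1"
  shows "\<Phi> a \<le> N / (2 * (1 - q)) * \<Phi> (\<lambda>k. (1 + of_real \<rho> ^ k) * a k)"
proof -
  let ?x = "\<lambda>k. complex_of_real \<rho> ^ k"
  let ?b = "\<lambda>k. (1 + ?x k) * a k"
  have fact: "2 ^ N - (1 - x) ^ N = (\<Sum>i<N. 2 ^ (N - Suc i) * (1 - x) ^ i) * (1 + x)" for x :: complex
    using power_diff_sumr2[of "1 - x" N 2] by (simp add: algebra_simps)
  have "2 ^ N * \<Phi> a - q * 2 ^ N * \<Phi> a \<le> \<Phi> (\<lambda>k. 2 ^ N * a k) - \<Phi> (\<lambda>k. (1 - ?x k) ^ N * a k)"
    using power_gap[OF assms, of a] homogeneous[of "2 ^ N" a] by (simp add: norm_power)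
  also have "\<dots> \<le> \<Phi> (\<lambda>k. 2 ^ N * a k - (1 - ?x k) ^ N * a k)" by (rule triangle_sub)
  also have "(\<lambda>k. 2 ^ N * a k - (1 - ?x k) ^ N * a k) = (\<lambda>k. \<Sum>i<N. 2 ^ (N - Suc i) * ((1 - ?x k) ^ i * ?b k))"
    by (simp add: fact sum_distrib_right mult.assoc flip: left_diff_distrib)
  also have "\<Phi> \<dots> \<le> (\<Sum>i<N. \<Phi> (\<lambda>k. 2 ^ (N - Suc i) * ((1 - ?x k) ^ i * ?b k)))"
    by (rule triangle_sum) simp
  also have "\<dots> \<le> (\<Sum>i<N. 2 ^ (N - 1) * \<Phi> ?b)"
  proof (rule sum_mono)
    fix i assume i: "i \<in> {..<N}"
    have "\<Phi> (\<lambda>k. 2 ^ (N - Suc i) * ((1 - ?x k) ^ i * ?b k)) = 2 ^ (N - Suc i) * \<Phi> (\<lambda>k. (1 - ?x k) ^ i * ?b k)"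
      by (simp add: homogeneous norm_power)
    also have "\<dots> \<le> 2 ^ (N - Suc i) * (2 ^ i * \<Phi> ?b)"
      using assms by (intro mult_left_mono one_minus_noise_power_le) auto
    also have "\<dots> = 2 ^ (N - 1) * \<Phi> ?b" using i by (simp flip: power_add mult.assoc)
    finally show "\<Phi> (\<lambda>k. 2 ^ (N - Suc i) * ((1 - ?x k) ^ i * ?b k)) \<le> 2 ^ (N - 1) * \<Phi> ?b" .
  qed
  also have "\<dots> = 2 ^ N * (N / 2 * \<Phi> ?b)"
    using N by (cases N) auto
  finally have "2 ^ N * ((1 - q) * \<Phi> a) \<le> 2 ^ N * (N / 2 * \<Phi> ?b)" by (simp add: algebra_simps)
  then have "(1 - q) * \<Phi> a \<le> N / 2 * \<Phi> ?b" by simp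
  then show ?thesis using q by (simp add: field_simps)
qed

text \<open>Kato's argument. Let \<open>T\<close> be the noise operator with \<open>\<rho> = exp (-t/m)\<close> and \<open>\<zeta> = exp (\<plusminus>\<i> pi / m)\<close>. As \<open>\<zeta> ^ m = -1\<close>, the operator
\<open>1 + T ^ m = -(\<zeta> ^ m - T ^ m)\<close> is the product of \<open>\<zeta> - T\<close> and a sum of \<open>m\<close> contractions. The preceding
lemma thus bounds \<open>\<Phi> a\<close>, up to its constant, by the norm of \<open>m (\<zeta> - T) a\<close>, and \<open>m (\<zeta> - T)\<close> tends to \<open>\<plusminus>\<i> pi + t \<Delta>\<close> as \<open>m\<close> grows. Finally \<open>t = pi \<bar>s\<bar>\<close>
makes this a multiple of \<open>1 - \<i> s \<Delta>\<close>.\<close>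

lemma le_resolvent_imaginary:
  fixes s :: real
  shows "\<Phi> a \<le> resolvent_bound N q * \<Phi> (\<lambda>k. (1 - \<i> * s * k) * a k)"
proof (cases "s = 0")
  case True
  have "\<Phi> a \<le> resolvent_bound N q * \<Phi> a"
    using mult_right_mono[of 1 "resolvent_bound N q" "\<Phi> a"] nonneg by (simp add: resolvent_bound_def)
  then show ?thesis using True by simp
next
  case False
  define \<sigma> t where "\<sigma> = sgn s" and "t = pi * \<bar>s\<bar>"
  have \<sigma>: "\<sigma> = 1 \<or> \<sigma> = -1" "s = \<sigma> * t / pi" "\<sigma> * \<sigma> = 1" and t: "0 < t"
    using False by (auto simp: \<sigma>_def t_def sgn_real_def)
  define C where "C = N / (2 * (1 - q))"
  have C: "0 \<le> C" using q by (simp add: C_def)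
  define E where "E m k = of_nat m * (exp (\<i> * (\<sigma> * pi) / of_nat m) - exp (- complex_of_real t * of_nat k / of_nat m))"
    for m k :: nat
  have "\<Phi> a \<le> C * \<Phi> (\<lambda>k. E m k * a k)" if m: "0 < m" for m
  proof -
    define \<zeta> where "\<zeta> = exp (\<i> * (\<sigma> * pi) / of_nat m)"
    define \<rho> where "\<rho> = exp (- t / m)"
    have \<rho>: "0 \<le> \<rho>" "\<rho> \<le> 1" using t by (auto simp: \<rho>_def)
    have \<zeta>m: "\<zeta> ^ m = -1" using m \<sigma>(1) exp_pi_i'
      by (auto simp: \<zeta>_def exp_minus mult.commute simp flip: exp_of_nat_mult)
    have "\<Phi> a \<le> C * \<Phi> (\<lambda>k. (1 + of_real (\<rho> ^ m) ^ k) * a k)"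
      unfolding C_def using \<rho> by (intro le_one_plus_noise) (auto simp: power_le_one)
    also have "(\<lambda>k. (1 + of_real (\<rho> ^ m) ^ k) * a k) =
        (\<lambda>k. \<Sum>i<m. - (\<zeta> ^ i) * ((of_real \<rho> ^ k) ^ (m - Suc i) * ((\<zeta> - of_real \<rho> ^ k) * a k)))"
    proof
      fix k
      have "- (1 + of_real (\<rho> ^ m) ^ k) = \<zeta> ^ m - (complex_of_real \<rho> ^ k) ^ m"
        by (simp add: \<zeta>m mult.commute flip: power_mult)
      also have "\<dots> = (\<zeta> - of_real \<rho> ^ k) * (\<Sum>i<m. (of_real \<rho> ^ k) ^ (m - Suc i) * \<zeta> ^ i)"
        by (rule power_diff_sumr2)
      finally have "1 + of_real (\<rho> ^ m) ^ k = - ((\<zeta> - of_real \<rho> ^ k) * (\<Sum>i<m. (of_real \<rho> ^ k) ^ (m - Suc i) * \<zeta> ^ i))"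
        by (metis minus_minus)
      then show "(1 + of_real (\<rho> ^ m) ^ k) * a k =
          (\<Sum>i<m. - (\<zeta> ^ i) * ((of_real \<rho> ^ k) ^ (m - Suc i) * ((\<zeta> - of_real \<rho> ^ k) * a k)))"
        by (simp add: sum_distrib_left sum_distrib_right sum_negf mult_ac)
    qed
    also have "\<Phi> \<dots> \<le> (\<Sum>i<m. \<Phi> (\<lambda>k. - (\<zeta> ^ i) * ((of_real \<rho> ^ k) ^ (m - Suc i) * ((\<zeta> - of_real \<rho> ^ k) * a k))))"
      by (rule triangle_sum) simp
    also have "\<dots> \<le> (\<Sum>i<m. \<Phi> (\<lambda>k. (\<zeta> - of_real \<rho> ^ k) * a k))"
    proof (rule sum_mono)
      fix i
      have "cmod (- (\<zeta> ^ i)) = 1" by (simp add: norm_power \<zeta>_def)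
      then show "\<Phi> (\<lambda>k. - (\<zeta> ^ i) * ((of_real \<rho> ^ k) ^ (m - Suc i) * ((\<zeta> - of_real \<rho> ^ k) * a k)))
          \<le> \<Phi> (\<lambda>k. (\<zeta> - of_real \<rho> ^ k) * a k)"
        unfolding homogeneous using noise_power_le[OF \<rho>] by simp
    qed
    also have "\<dots> = \<Phi> (\<lambda>k. of_nat m * ((\<zeta> - of_real \<rho> ^ k) * a k))"
      by (simp add: homogeneous)
    also have "(\<lambda>k. of_nat m * ((\<zeta> - of_real \<rho> ^ k) * a k)) = (\<lambda>k. E m k * a k)"
    proof
      fix k
      have "complex_of_real \<rho> ^ k = exp (- complex_of_real t * of_nat k / of_nat m)"
        unfolding \<rho>_def by (simp add: exp_of_real[symmetric] mult.commute flip: exp_of_nat_mult)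
      then show "of_nat m * ((\<zeta> - of_real \<rho> ^ k) * a k) = E m k * a k"
        by (simp add: E_def \<zeta>_def)
    qed
    finally show ?thesis using C by (simp add: mult_left_mono)
  qed
  then have ev: "\<forall>\<^sub>F m in sequentially. \<Phi> a \<le> C * \<Phi> (\<lambda>k. E m k * a k)"
    using eventually_gt_at_top[of "0::nat"] by (rule eventually_mono[rotated]) auto
  have "(\<lambda>m. E m k) \<longlonglongrightarrow> \<i> * (\<sigma> * pi) - (- complex_of_real t * of_nat k)" for k
    using tendsto_diff[OF tendsto_exp_diff_quotient tendsto_exp_diff_quotient,
        of "\<i> * (\<sigma> * pi)" "- complex_of_real t * of_nat k"]
    by (simp add: E_def algebra_simps)
  then have "(\<lambda>m. C * \<Phi> (\<lambda>k. E m k * a k)) \<longlonglongrightarrow> C * \<Phi> (\<lambda>k. (\<i> * (\<sigma> * pi) - (- complex_of_real t * of_nat k)) * a k)"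
    by (intro tendsto_mult tendsto_const tendsto_seminorm)
  from tendsto_lowerbound[OF this ev]
  have "\<Phi> a \<le> C * \<Phi> (\<lambda>k. (\<i> * (\<sigma> * pi) - (- complex_of_real t * of_nat k)) * a k)" by simp
  also have "(\<lambda>k. (\<i> * (\<sigma> * pi) - (- complex_of_real t * of_nat k)) * a k)
      = (\<lambda>k. (\<i> * (\<sigma> * pi)) * ((1 - \<i> * s * k) * a k))"
  proof
    fix k :: nat
    have "t = \<sigma> * pi * s" by (simp add: t_def \<sigma>_def abs_sgn)
    then show "(\<i> * (\<sigma> * pi) - (- complex_of_real t * of_nat k)) * a k
      = (\<i> * (\<sigma> * pi)) * ((1 - \<i> * s * k) * a k)"
      by (simp add: algebra_simps)
  qed
  also have "\<Phi> \<dots> = pi * \<Phi> (\<lambda>k. (1 - \<i> * s * k) * a k)"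
    unfolding homogeneous using \<sigma>(1) by (auto simp: norm_mult)
  finally have "\<Phi> a \<le> (pi * C) * \<Phi> (\<lambda>k. (1 - \<i> * s * k) * a k)" by (simp add: mult_ac)
  also have "\<dots> \<le> resolvent_bound N q * \<Phi> (\<lambda>k. (1 - \<i> * s * k) * a k)"
    by (intro mult_right_mono nonneg) (simp add: resolvent_bound_def C_def)
  finally show ?thesis .
qed

text \<open>On the imaginary axis, the estimate also controls \<open>\<bar>Im w\<bar> \<Delta>\<close> by the operator \<open>1 - \<i> (Im w) \<Delta>\<close>. If \<open>\<bar>Re w\<bar>\<close> is a
small multiple of \<open>\<bar>Im w\<bar>\<close>, then \<open>(Re w) \<Delta>\<close> is a small perturbation.\<close>

lemma le_resolvent_sector:
  fixes w :: complex
  assumes w: "2 * (1 + resolvent_bound N q) * \<bar>Re w\<bar> \<le> \<bar>Im w\<bar>"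
  shows "\<Phi> a \<le> 2 * resolvent_bound N q * \<Phi> (\<lambda>k. (1 - w * k) * a k)"
proof -
  let ?M = "resolvent_bound N q"
  have M: "1 \<le> ?M" by (simp add: resolvent_bound_def)
  let ?b = "\<lambda>k. (1 - \<i> * Im w * k) * a k"
  have b: "\<Phi> a \<le> ?M * \<Phi> ?b" by (rule le_resolvent_imaginary)
  have "2 * \<Phi> (\<lambda>k. Re w * (k * a k)) \<le> \<Phi> ?b"
  proof -
    have "\<Phi> (\<lambda>k. \<i> * Im w * (k * a k)) = \<Phi> (\<lambda>k. a k - ?b k)" by (simp add: algebra_simps)
    also have "\<dots> \<le> \<Phi> a + \<Phi> ?b" by (rule triangle_diff)
    also have "\<dots> \<le> (1 + ?M) * \<Phi> ?b" using b by (simp add: algebra_simps)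
    finally have "\<bar>Im w\<bar> * \<Phi> (\<lambda>k. k * a k) \<le> (1 + ?M) * \<Phi> ?b"
      unfolding homogeneous by (simp add: norm_mult)
    moreover have "2 * (1 + ?M) * \<bar>Re w\<bar> * \<Phi> (\<lambda>k. k * a k) \<le> \<bar>Im w\<bar> * \<Phi> (\<lambda>k. k * a k)"
      using w by (intro mult_right_mono nonneg)
    ultimately have "2 * (1 + ?M) * \<bar>Re w\<bar> * \<Phi> (\<lambda>k. k * a k) \<le> (1 + ?M) * \<Phi> ?b"
      by (rule order_trans[rotated])
    then have "(1 + ?M) * (2 * (\<bar>Re w\<bar> * \<Phi> (\<lambda>k. k * a k))) \<le> (1 + ?M) * \<Phi> ?b"
      by (simp only: mult_ac)
    then show ?thesis unfolding homogeneous using M by (simp add: mult_le_cancel_left)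
  qed
  moreover have "\<Phi> ?b - \<Phi> (\<lambda>k. Re w * (k * a k)) \<le> \<Phi> (\<lambda>k. ?b k - Re w * (k * a k))"
    by (rule triangle_sub)
  moreover have "(\<lambda>k. ?b k - Re w * (k * a k)) = (\<lambda>k. (1 - w * k) * a k)"
  proof
    fix k :: nat
    have "w = Re w + \<i> * Im w" by (rule complex_eq)
    then show "?b k - Re w * (k * a k) = (1 - w * k) * a k"
      by (metis (no_types, lifting) add.commute diff_diff_add left_diff_distrib mult.assoc distrib_right)
  qed
  ultimately have "\<Phi> ?b \<le> 2 * \<Phi> (\<lambda>k. (1 - w * k) * a k)" by simp
  then have "?M * \<Phi> ?b \<le> ?M * (2 * \<Phi> (\<lambda>k. (1 - w * k) * a k))" using M by (intro mult_left_mono) auto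
  then show ?thesis using b by simp
qed

text \<open>The projection to a single level is the interpolation polynomial in the noise operator that vanishes at all the other eigenvalues \<open>\<rho> ^ i\<close>. The
choice \<open>\<rho> = 1 - 1/(2d)\<close> separates the eigenvalues \<open>1, \<rho>, \<dots>, \<rho> ^ d\<close> by at least \<open>1/(4d)\<close>. Only the logarithm of the bound matters later, and
for this \<open>O(d ln d)\<close> suffices.\<close>

lemma coord_le:
  assumes j: "j \<le> d"
  shows "\<Phi> (coord j) \<le> (8 * real d) ^ d * \<Phi> (\<lambda>k. 1)"
proof (cases "d = 0")
  case True
  then have "\<Phi> (coord j) = \<Phi> (\<lambda>k. 1)" using j by (intro cutoff) (auto simp: coord_def)
  then show ?thesis using True by simp
next
  case False
  then have d: "1 \<le> d" by simp
  define \<rho> where "\<rho> = 1 - 1 / (2 * real d)"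
  have \<rho>: "1/2 \<le> \<rho>" "\<rho> < 1" using d by (auto simp: \<rho>_def field_simps)
  have \<rho>d: "1/2 \<le> \<rho> ^ d"
    using Bernoulli_inequality[of "- (1 / (2 * real d))" d] d by (simp add: \<rho>_def field_simps)
  have gap: "1 / (4 * real d) \<le> \<rho> ^ i - \<rho> ^ k" if "i < k" "k \<le> d" for i k
  proof -
    have "1 / (4 * real d) = 1/2 * (1 - \<rho>)" using d by (simp add: \<rho>_def)
    also have "\<dots> \<le> \<rho> ^ i * (1 - \<rho> ^ (k - i))"
    proof (rule mult_mono)
      show "1/2 \<le> \<rho> ^ i" using \<rho>d power_decreasing[of i d \<rho>] \<rho> that by linarith
      show "1 - \<rho> \<le> 1 - \<rho> ^ (k - i)" using power_decreasing[of 1 "k - i" \<rho>] \<rho> that by simp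
    qed (use \<rho> in auto)
    also have "\<dots> = \<rho> ^ i - \<rho> ^ k" using that by (simp add: right_diff_distrib flip: power_add)
    finally show ?thesis .
  qed
  define c where "c i = \<rho> ^ j - \<rho> ^ i" for i
  have c: "1 / (4 * real d) \<le> \<bar>c i\<bar>" if "i \<le> d" "i \<noteq> j" for i
    using gap[of i j] gap[of j i] that j by (cases "i < j") (auto simp: c_def)
  have "\<Phi> (\<lambda>k. (\<Prod>i\<in>I. (of_real \<rho> ^ k - of_real \<rho> ^ i) / of_real (c i)) * a k) \<le> (8 * real d) ^ card I * \<Phi> a"
    if "finite I" "I \<subseteq> {..d} - {j}" for I a
    using that
  proof (induction I rule: finite_induct)
    case (insert i I)
    let ?b = "\<lambda>k. (\<Prod>i\<in>I. (of_real \<rho> ^ k - of_real \<rho> ^ i) / of_real (c i)) * a k"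
    have "\<Phi> (\<lambda>k. of_real \<rho> ^ k * ?b k - of_real \<rho> ^ i * ?b k) \<le> \<Phi> (\<lambda>k. of_real \<rho> ^ k * ?b k) + \<Phi> (\<lambda>k. of_real \<rho> ^ i * ?b k)"
      by (rule triangle_diff)
    also have "\<Phi> (\<lambda>k. of_real \<rho> ^ i * ?b k) \<le> \<Phi> ?b"
      unfolding homogeneous using \<rho> nonneg[of ?b] by (simp add: norm_power mult_left_le_one_le power_le_one)
    also have "\<Phi> (\<lambda>k. of_real \<rho> ^ k * ?b k) \<le> \<Phi> ?b" using \<rho> by (intro noise_le) auto
    finally have *: "\<Phi> (\<lambda>k. of_real \<rho> ^ k * ?b k - of_real \<rho> ^ i * ?b k) \<le> 2 * \<Phi> ?b" by simp
    have ci: "1 / \<bar>c i\<bar> \<le> 4 * real d"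
      using frac_le[of 1 1 "1 / (4 * real d)" "\<bar>c i\<bar>"] c[of i] insert.prems d by auto
    have "\<Phi> (\<lambda>k. (\<Prod>i\<in>insert i I. (of_real \<rho> ^ k - of_real \<rho> ^ i) / of_real (c i)) * a k)
       = \<Phi> (\<lambda>k. (1 / of_real (c i)) * (of_real \<rho> ^ k * ?b k - of_real \<rho> ^ i * ?b k))"
      using insert.hyps by (simp add: algebra_simps diff_divide_distrib)
    also have "\<dots> = 1 / \<bar>c i\<bar> * \<Phi> (\<lambda>k. of_real \<rho> ^ k * ?b k - of_real \<rho> ^ i * ?b k)"
      unfolding homogeneous by (simp add: norm_divide)
    also have "\<dots> \<le> 4 * real d * (2 * \<Phi> ?b)"
      using * ci nonneg by (intro mult_mono) auto
    also have "\<dots> \<le> 4 * real d * (2 * ((8 * real d) ^ card I * \<Phi> a))"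
      using insert by (intro mult_left_mono) auto
    finally show ?case using insert.hyps by (simp add: mult_ac)
  qed simp
  from this[of "{..d} - {j}" "\<lambda>k. 1"] have
    "\<Phi> (\<lambda>k. (\<Prod>i\<in>{..d} - {j}. (of_real \<rho> ^ k - of_real \<rho> ^ i) / of_real (c i)) * 1) \<le> (8 * real d) ^ d * \<Phi> (\<lambda>k. 1)"
    using j by simp
  also have "\<Phi> (\<lambda>k. (\<Prod>i\<in>{..d} - {j}. (of_real \<rho> ^ k - of_real \<rho> ^ i) / of_real (c i)) * 1) = \<Phi> (coord j)"
  proof (rule cutoff)
    fix k assume k: "k \<le> d"
    show "(\<Prod>i\<in>{..d} - {j}. (of_real \<rho> ^ k - of_real \<rho> ^ i) / of_real (c i)) * 1 = coord j k"
    proof (cases "k = j")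
      case True
      have "(of_real \<rho> ^ k - of_real \<rho> ^ i) / of_real (c i) = (1::complex)" if "i \<in> {..d} - {j}" for i
      proof -
        have "0 < 1 / (4 * real d)" using d by simp
        also have "\<dots> \<le> \<bar>c i\<bar>" using that c by auto
        finally have "c i \<noteq> 0" by simp
        moreover have "of_real \<rho> ^ k - of_real \<rho> ^ i = complex_of_real (c i)"
          using True by (simp add: c_def)
        ultimately show ?thesis by simp
      qed
      then show ?thesis using True by (simp add: coord_def)
    next
      case False
      then show ?thesis using k by (auto simp: coord_def intro!: prod_zero bexI[of _ k])
    qed
  qed
  finally show ?thesis .
qed

lemma resolvent_small_disc:
  assumes d: "1 \<le> d" and w: "cmod w \<le> 1 / (2 * real d)"
  shows "\<Phi> (\<lambda>k. 1 / (1 - w * k)) \<le> 2 * (real d + 1) * (8 * real d) ^ d * \<Phi> (\<lambda>k. 1)"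
proof -
  have small: "cmod (1 / (1 - w * of_nat j)) \<le> 2" if "j \<le> d" for j
  proof -
    have "cmod (w * of_nat j) \<le> 1 / (2 * real d) * real d"
      unfolding norm_mult using w that by (intro mult_mono) auto
    also have "\<dots> = 1/2" using d by simp
    finally have "1/2 \<le> cmod (1 - w * of_nat j)"
      using norm_triangle_ineq2[of 1 "w * of_nat j"] by simp
    then show ?thesis
      using frac_le[of 1 1 "1/2" "cmod (1 - w * of_nat j)"] by (simp add: norm_divide)
  qed
  have "\<Phi> (\<lambda>k. 1 / (1 - w * k)) \<le> (\<Sum>j\<le>d. cmod (1 / (1 - w * of_nat j)) * \<Phi> (coord j))"
    by (rule le_sum_coords)
  also have "\<dots> \<le> (\<Sum>j\<le>d. 2 * ((8 * real d) ^ d * \<Phi> (\<lambda>k. 1)))"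
    using small by (intro sum_mono mult_mono coord_le nonneg) auto
  finally show ?thesis by (simp add: algebra_simps)
qed

end

context noise_seminorm
begin

section \<open>The resolvent near the origin\<close>

text \<open>On the rays bounding the cone, \<open>le_resolvent_sector\<close> applies. On the arc of radius \<open>1/(2d)\<close>, the damping factor
\<open>exp (- L u powr \<beta>)\<close> outweighs the crude bound, because \<open>Re (u powr \<beta>) \<ge> cos (\<beta> \<psi>) \<bar>u\<bar> powr \<beta>\<close> in the cone of half-angle \<open>\<psi> = arctan \<kappa>\<close>
and \<open>\<beta> \<psi> < pi / 2\<close>. The maximum principle for the damped resolvent then bounds it inside. The sign \<open>\<sigma>\<close> covers
both halves of the double cone with one branch of the power.\<close>

lemma resolvent_corner:
  fixes \<beta> L \<sigma> :: real and u :: complex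
  defines "\<kappa> \<equiv> 2 * (1 + resolvent_bound N q)"
  assumes d: "1 \<le> d" and \<sigma>: "\<bar>\<sigma>\<bar> = 1"
    and \<beta>: "1 < \<beta>" "\<beta> * arctan \<kappa> < pi / 2"
    and L: "2 * (real d + 1) * (8 * real d) ^ d \<le> exp (L * cos (\<beta> * arctan \<kappa>) * (1 / (2 * real d)) powr \<beta>)" "0 \<le> L"
    and u: "\<bar>Im u\<bar> \<le> \<kappa> * Re u" "cmod u < 1 / (2 * real d)"
  shows "\<Phi> (\<lambda>k. 1 / (1 - \<sigma> * u * k)) \<le> 2 * resolvent_bound N q * \<Phi> (\<lambda>k. 1) * exp (L * cmod u powr \<beta>)"
proof -
  let ?M = "resolvent_bound N q" and ?r = "1 / (2 * real d)"
  have M: "1 \<le> ?M" by (simp add: resolvent_bound_def)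
  then have \<kappa>: "0 < \<kappa>" by (simp add: \<kappa>_def)
  have r: "0 < ?r" using d by simp
  have \<Phi>1: "0 \<le> \<Phi> (\<lambda>k. 1)" by (rule nonneg)
  define F where "F u k = exp (- (of_real L * u powr of_real \<beta>)) / (1 - \<sigma> * u * of_nat k)" for u :: complex and k :: nat
  have F: "\<Phi> (F u) = exp (- L * Re (u powr of_real \<beta>)) * \<Phi> (\<lambda>k. 1 / (1 - \<sigma> * u * k))" for u :: complex
    using homogeneous[of "exp (- (of_real L * u powr of_real \<beta>))" "\<lambda>k. 1 / (1 - \<sigma> * u * k)"]
    by (simp add: F_def[abs_def])
  have nz: "1 - \<sigma> * u * of_nat k \<noteq> 0" if "cmod u \<le> ?r" "k \<le> d" for u :: complex and k
  proof
    assume "1 - \<sigma> * u * of_nat k = 0"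
    then have "1 = cmod (\<sigma> * u * of_nat k)" by simp
    also have "\<dots> = cmod u * real k" using \<sigma> by (simp add: norm_mult)
    also have "\<dots> \<le> ?r * real d" using that by (intro mult_mono) auto
    finally show False using d by simp
  qed
  have powr: "cos (\<beta> * arctan \<kappa>) * cmod u powr \<beta> \<le> Re (u powr of_real \<beta>)"
    "Re (u powr of_real \<beta>) \<le> cmod u powr \<beta>" if "\<bar>Im u\<bar> \<le> \<kappa> * Re u" for u :: complex
  proof -
    show "Re (u powr of_real \<beta>) \<le> cmod u powr \<beta>"
      using complex_Re_le_cmod[of "u powr of_real \<beta>"] by (simp add: norm_powr_real_powr')
    show "cos (\<beta> * arctan \<kappa>) * cmod u powr \<beta> \<le> Re (u powr of_real \<beta>)"
    proof (cases "u = 0")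
      case False
      have "0 < Re u"
      proof (rule ccontr)
        assume "\<not> 0 < Re u"
        then have "\<kappa> * Re u \<le> 0" using \<kappa> by (simp add: mult_le_0_iff)
        with that have "\<kappa> * Re u = 0" "Im u = 0" by linarith+
        then show False using False \<kappa> by (simp add: complex_eq_iff)
      qed
      then have Ln: "Im (Ln u) = arctan (Im u / Re u)"
        using arg_conv_arctan[of u] False by (simp add: Arg_eq_Im_Ln)
      have "Im u / Re u \<le> \<kappa>" "-\<kappa> \<le> Im u / Re u"
        using that \<open>0 < Re u\<close> by (auto simp: field_simps abs_le_iff)
      then have "arctan (Im u / Re u) \<le> arctan \<kappa>" "- arctan \<kappa> \<le> arctan (Im u / Re u)"
        by (auto simp: arctan_le_iff simp flip: arctan_minus)
      then have "\<bar>arctan (Im u / Re u)\<bar> \<le> arctan \<kappa>" by linarith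
      then have arg: "\<bar>\<beta> * Im (Ln u)\<bar> \<le> \<beta> * arctan \<kappa>"
        using \<beta> by (simp add: Ln abs_mult)
      have "cos (\<beta> * arctan \<kappa>) \<le> cos \<bar>\<beta> * Im (Ln u)\<bar>"
        using arg \<beta> pi_gt_zero by (intro cos_monotone_0_pi_le) auto
      then have "cos (\<beta> * arctan \<kappa>) \<le> cos (\<beta> * Im (Ln u))" by simp
      moreover have "Re (u powr of_real \<beta>) = cmod u powr \<beta> * cos (\<beta> * Im (Ln u))"
        using False by (simp add: powr_def Re_exp)
      ultimately show ?thesis by (metis mult.commute mult_right_mono powr_ge_zero)
    qed (use \<beta> in simp)
  qed
  have cos_pos: "0 < cos (\<beta> * arctan \<kappa>)"
    using \<beta> \<kappa> by (intro cos_gt_zero) (auto simp: zero_less_arctan_iff)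
  have ray: "\<Phi> (F u) \<le> 2 * ?M * \<Phi> (\<lambda>k. 1)" if "\<bar>Im u\<bar> = \<kappa> * Re u" "cmod u \<le> ?r" for u :: complex
  proof -
    have "0 \<le> Re u" using that(1) \<kappa> by (metis abs_ge_zero zero_le_mult_iff not_less less_le)
    let ?w = "\<sigma> * u"
    have "\<Phi> (\<lambda>k. 1 / (1 - ?w * k)) \<le> 2 * ?M * \<Phi> (\<lambda>k. (1 - ?w * k) * (1 / (1 - ?w * k)))"
      using that(1) \<sigma> \<open>0 \<le> Re u\<close> by (intro le_resolvent_sector) (simp add: abs_mult \<kappa>_def)
    also have "\<Phi> (\<lambda>k. (1 - ?w * k) * (1 / (1 - ?w * k))) = \<Phi> (\<lambda>k. 1)"
      using nz[OF that(2)] by (intro cutoff) simp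
    finally have *: "\<Phi> (\<lambda>k. 1 / (1 - ?w * k)) \<le> 2 * ?M * \<Phi> (\<lambda>k. 1)" .
    have "0 \<le> cos (\<beta> * arctan \<kappa>) * cmod u powr \<beta>" using cos_pos by simp
    also have "\<dots> \<le> Re (u powr of_real \<beta>)" using that by (intro powr) simp
    finally have "exp (- L * Re (u powr of_real \<beta>)) \<le> 1" using L by (simp add: mult_nonneg_nonneg)
    then have "\<Phi> (F u) \<le> 1 * \<Phi> (\<lambda>k. 1 / (1 - ?w * k))"
      unfolding F by (intro mult_right_mono nonneg)
    with * show ?thesis by simp
  qed
  have arc: "\<Phi> (F u) \<le> 2 * ?M * \<Phi> (\<lambda>k. 1)" if "\<bar>Im u\<bar> \<le> \<kappa> * Re u" "cmod u = ?r" for u :: complex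
  proof -
    have "\<Phi> (\<lambda>k. 1 / (1 - (\<sigma> * u) * k)) \<le> 2 * (real d + 1) * (8 * real d) ^ d * \<Phi> (\<lambda>k. 1)"
      using d that \<sigma> by (intro resolvent_small_disc) (auto simp: norm_mult)
    also have "\<dots> \<le> exp (L * Re (u powr of_real \<beta>)) * \<Phi> (\<lambda>k. 1)"
    proof (rule mult_right_mono[OF _ \<Phi>1])
      have "L * cos (\<beta> * arctan \<kappa>) * ?r powr \<beta> \<le> L * Re (u powr of_real \<beta>)"
        using powr(1)[OF that(1)] L that(2) by (simp add: mult_left_mono mult.assoc)
      then show "2 * (real d + 1) * (8 * real d) ^ d \<le> exp (L * Re (u powr of_real \<beta>))"
        using L(1) by (meson exp_le_cancel_iff order_trans)
    qed
    finally have "\<Phi> (F u) \<le> exp (- L * Re (u powr of_real \<beta>)) * (exp (L * Re (u powr of_real \<beta>)) * \<Phi> (\<lambda>k. 1))"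
      unfolding F by (intro mult_left_mono) auto
    also have "\<dots> = 1 * \<Phi> (\<lambda>k. 1)" by (simp add: exp_minus flip: mult.assoc)
    also have "\<dots> \<le> 2 * ?M * \<Phi> (\<lambda>k. 1)" using M \<Phi>1 by (intro mult_right_mono) auto
    finally show ?thesis .
  qed
  define G where "G = {u. \<bar>Im u\<bar> < \<kappa> * Re u \<and> cmod u < ?r}"
  define H where "H = {u. \<bar>Im u\<bar> \<le> \<kappa> * Re u \<and> cmod u \<le> ?r}"
  have "open G" unfolding G_def
    by (intro open_Collect_conj open_Collect_less continuous_intros)
  have "bounded G" unfolding G_def bounded_iff by (intro exI[of _ ?r]) auto
  have "closed H" unfolding H_def
    by (intro closed_Collect_conj closed_Collect_le continuous_intros)
  then have clH: "closure G \<subseteq> H" by (intro closure_minimal) (auto simp: G_def H_def)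
  have Hpos: "0 \<le> Re u" if "u \<in> H" for u :: complex
    using that \<kappa> by (auto simp: H_def) (smt (verit) mult_pos_neg)
  have holF: "(\<lambda>u. F u k) holomorphic_on G" if "k \<le> d" for k
  proof -
    have "0 < Re u" if "u \<in> G" for u :: complex
      using that \<kappa> by (auto simp: G_def) (smt (verit) mult_nonneg_nonpos)
    then have "u \<notin> \<real>\<^sub>\<le>\<^sub>0" if "u \<in> G" for u :: complex
      using that by (force elim!: nonpos_Reals_cases)
    moreover have "1 - \<sigma> * u * of_nat k \<noteq> 0" if "u \<in> G" for u :: complex
      using nz[of u k] that \<open>k \<le> d\<close> by (auto simp: G_def)
    ultimately show ?thesis unfolding F_def by (intro holomorphic_intros) auto
  qed
  have contF: "continuous_on (closure G) (\<lambda>u. F u k)" if "k \<le> d" for k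
  proof (rule continuous_on_subset[OF _ clH])
    have "1 - \<sigma> * u * of_nat k \<noteq> 0" if "u \<in> H" for u :: complex
      using nz[of u k] that \<open>k \<le> d\<close> by (auto simp: H_def)
    then show "continuous_on H (\<lambda>u. F u k)"
      unfolding F_def using Hpos \<beta> by (intro continuous_intros) auto
  qed
  have bdF: "\<Phi> (F u) \<le> 2 * ?M * \<Phi> (\<lambda>k. 1)" if "u \<in> frontier G" for u :: complex
  proof -
    have "u \<in> H" "u \<notin> G"
      using that clH \<open>open G\<close> by (auto simp: frontier_def interior_open)
    then have "\<bar>Im u\<bar> = \<kappa> * Re u \<or> cmod u = ?r" by (auto simp: G_def H_def)
    then show ?thesis using \<open>u \<in> H\<close> ray[of u] arc[of u] by (auto simp: H_def)
  qed
  have "\<Phi> (F u) \<le> 2 * ?M * \<Phi> (\<lambda>k. 1)"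
  proof (cases "u \<in> G")
    case True
    show ?thesis by (rule maximum_principle[OF \<open>open G\<close> \<open>bounded G\<close> holF contF bdF True])
  next
    case False
    then have "\<bar>Im u\<bar> = \<kappa> * Re u" using u by (auto simp: G_def)
    then show ?thesis using u by (intro ray) auto
  qed
  then have "\<Phi> (\<lambda>k. 1 / (1 - \<sigma> * u * k)) \<le> 2 * ?M * \<Phi> (\<lambda>k. 1) * exp (L * Re (u powr of_real \<beta>))"
    unfolding F by (simp add: exp_minus field_simps)
  also have "\<dots> \<le> 2 * ?M * \<Phi> (\<lambda>k. 1) * exp (L * cmod u powr \<beta>)"
    using powr(2)[OF u(1)] L M \<Phi>1 by (intro mult_left_mono) (auto intro: mult_left_mono)
  finally show ?thesis .
qed

text \<open>The function \<open>k / (1 - w k) = (1 / (1 - w k) - 1) / w\<close> is holomorphic on the disc of radius \<open>r\<close>, equals \<open>k\<close> at the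
centre and is controlled by the resolvent on the circle. The maximum principle thus plays the role of Cauchy's estimate.\<close>

lemma derivative_bound:
  fixes \<beta> L r :: real
  defines "\<kappa> \<equiv> 2 * (1 + resolvent_bound N q)"
  assumes d: "1 \<le> d"
    and \<beta>: "1 < \<beta>" "\<beta> * arctan \<kappa> < pi / 2"
    and L: "2 * (real d + 1) * (8 * real d) ^ d \<le> exp (L * cos (\<beta> * arctan \<kappa>) * (1 / (2 * real d)) powr \<beta>)" "0 \<le> L"
    and r: "0 < r" "r < 1 / (2 * real d)" "L * r powr \<beta> \<le> 1"
  shows "\<Phi> (\<lambda>k. of_nat k) \<le> (6 * resolvent_bound N q + 1) / r * \<Phi> (\<lambda>k. 1)"
proof -
  let ?M = "resolvent_bound N q"
  have M: "1 \<le> ?M" by (simp add: resolvent_bound_def)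
  then have \<kappa>: "1 < \<kappa>" by (simp add: \<kappa>_def)
  have \<Phi>1: "0 \<le> \<Phi> (\<lambda>k. 1)" by (rule nonneg)
  have rd: "r * real k < 1" if "k \<le> d" for k
  proof -
    have "r * real k \<le> r * real d" using r that by (intro mult_left_mono) auto
    also have "\<dots> < 1" using r d by (simp add: field_simps)
    finally show ?thesis .
  qed
  have nz: "1 - w * of_nat k \<noteq> 0" if "cmod w \<le> r" "k \<le> d" for w k
  proof
    assume "1 - w * of_nat k = 0"
    then have "1 = cmod (w * of_nat k)" by simp
    also have "\<dots> \<le> r * real k" using that by (simp add: norm_mult mult_right_mono)
    finally show False using rd[OF that(2)] by simp
  qed
  have circle: "\<Phi> (\<lambda>k. 1 / (1 - w * k)) \<le> 6 * ?M * \<Phi> (\<lambda>k. 1)" if w: "cmod w = r" for w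
  proof (cases "\<kappa> * \<bar>Re w\<bar> \<le> \<bar>Im w\<bar>")
    case True
    then have "\<Phi> (\<lambda>k. 1 / (1 - w * k)) \<le> 2 * ?M * \<Phi> (\<lambda>k. (1 - w * k) * (1 / (1 - w * k)))"
      unfolding \<kappa>_def by (rule le_resolvent_sector)
    also have "\<Phi> (\<lambda>k. (1 - w * k) * (1 / (1 - w * k))) = \<Phi> (\<lambda>k. 1)"
      using nz[of w] w by (intro cutoff) simp
    also have "2 * ?M * \<Phi> (\<lambda>k. 1) \<le> 6 * ?M * \<Phi> (\<lambda>k. 1)"
      using M \<Phi>1 by (intro mult_right_mono) auto
    finally show ?thesis .
  next
    case False
    define \<sigma> where "\<sigma> = (if 0 \<le> Re w then 1 else -1 :: real)"
    have \<sigma>: "\<bar>\<sigma>\<bar> = 1" "\<sigma> * (\<sigma> * w) = w" "\<bar>Re w\<bar> = \<sigma> * Re w" by (auto simp: \<sigma>_def)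
    have "\<bar>Im w\<bar> \<le> \<kappa> * \<bar>Re w\<bar>" using False by simp
    then have "\<Phi> (\<lambda>k. 1 / (1 - \<sigma> * (\<sigma> * w) * k)) \<le> 2 * ?M * \<Phi> (\<lambda>k. 1) * exp (L * cmod (\<sigma> * w) powr \<beta>)"
      using d \<sigma> \<beta> L r w unfolding \<kappa>_def
      by (intro resolvent_corner) (auto simp: norm_mult abs_mult)
    also have "\<dots> \<le> 2 * ?M * \<Phi> (\<lambda>k. 1) * 3"
    proof (intro mult_left_mono)
      have "exp (L * cmod (\<sigma> * w) powr \<beta>) \<le> exp 1"
        using r(3) \<sigma>(1) w by (simp add: norm_mult)
      then show "exp (L * cmod (\<sigma> * w) powr \<beta>) \<le> 3" using exp_le by linarith
    qed (use M \<Phi>1 in simp)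
    finally show ?thesis by (simp only: \<sigma>(2))
  qed
  define F where "F w k = of_nat k / (1 - w * of_nat k)" for w :: complex and k :: nat
  have "\<Phi> (F 0) \<le> (6 * ?M + 1) / r * \<Phi> (\<lambda>k. 1)"
  proof (rule maximum_principle[where G = "ball 0 r"])
    show "(\<lambda>w. F w k) holomorphic_on ball 0 r" if "k \<le> d" for k
      unfolding F_def using nz[of _ k] that by (intro holomorphic_intros) auto
    show "continuous_on (closure (ball 0 r)) (\<lambda>w. F w k)" if "k \<le> d" for k
      unfolding F_def using nz[of _ k] that r(1) by (intro continuous_intros) auto
    show "\<Phi> (F w) \<le> (6 * ?M + 1) / r * \<Phi> (\<lambda>k. 1)" if "w \<in> frontier (ball 0 r)" for w
    proof -
      have w: "cmod w = r" using that r(1) by simp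
      then have "w \<noteq> 0" using r(1) by auto
      have "\<Phi> (F w) = \<Phi> (\<lambda>k. 1 / w * (1 / (1 - w * k) - 1))"
        using nz[of w] w \<open>w \<noteq> 0\<close> by (intro cutoff) (simp add: F_def field_simps)
      also have "\<dots> = 1 / r * \<Phi> (\<lambda>k. 1 / (1 - w * k) - 1)"
        unfolding homogeneous using w by (simp add: norm_divide)
      also have "\<dots> \<le> 1 / r * (6 * ?M * \<Phi> (\<lambda>k. 1) + \<Phi> (\<lambda>k. 1))"
        using circle[OF w] r(1) by (intro mult_left_mono order_trans[OF triangle_diff]) auto
      finally show ?thesis using r(1) by (simp add: field_simps)
    qed
  qed (use r in auto)
  then show ?thesis by (simp add: F_def[abs_def])
qed

end

text \<open>The exponent \<open>\<beta>\<close> is the midpoint between \<open>1\<close> and the largest value that the cone permits. The logarithm in the crude bound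
\<open>exp (O(d ln d))\<close> is absorbed into a power \<open>d powr \<eta>\<close> with \<open>(1 + \<eta>) / \<beta> < 1\<close>. The constants depend on \<open>N\<close> and \<open>q\<close>
only, which is what makes the final estimate independent of the dimension.\<close>

theorem noise_seminorm_derivative:
  fixes N :: nat and q :: real
  obtains \<alpha> C :: real where "1 \<le> \<alpha>" "\<alpha> < 2" "0 < C"
    "\<And>\<Phi> d. noise_seminorm \<Phi> d N q \<Longrightarrow> 1 \<le> d \<Longrightarrow>
       \<Phi> (\<lambda>k. of_nat k) \<le> C * real d powr \<alpha> * \<Phi> (\<lambda>k. 1)"
proof -
  define M where "M = resolvent_bound N q"
  define \<kappa> where "\<kappa> = 2 * (1 + M)"
  have M: "1 \<le> M" by (simp add: M_def resolvent_bound_def)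
  have at: "0 < arctan \<kappa>" "arctan \<kappa> < pi / 2"
    using M arctan_ubound[of \<kappa>] by (auto simp: \<kappa>_def zero_less_arctan_iff)
  define \<beta> where "\<beta> = (1 + pi / 2 / arctan \<kappa>) / 2"
  have *: "1 < pi / 2 / arctan \<kappa>" using at by (simp add: field_simps)
  have \<beta>: "1 < \<beta>" "\<beta> * arctan \<kappa> < pi / 2"
  proof -
    show "1 < \<beta>" using * by (simp add: \<beta>_def)
    have "\<beta> < pi / 2 / arctan \<kappa>" using * by (simp add: \<beta>_def)
    then show "\<beta> * arctan \<kappa> < pi / 2" using at by (simp add: field_simps)
  qed
  define c where "c = cos (\<beta> * arctan \<kappa>)"
  have c: "0 < c" "c \<le> 1" using \<beta> at by (auto simp: c_def intro!: cos_gt_zero)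
  define \<eta> where "\<eta> = (\<beta> - 1) / 2"
  have \<eta>: "0 < \<eta>" "(1 + \<eta>) / \<beta> < 1" using \<beta> by (auto simp: \<eta>_def field_simps)
  define B where "B = 2 * 8 powr \<eta> / \<eta> + 1"
  have B: "1 < B" using \<eta> by (simp add: B_def)
  define \<alpha> where "\<alpha> = 1 + (1 + \<eta>) / \<beta>"
  define C where "C = (6 * M + 1) * (2 * (B / c) powr (1 / \<beta>))"
  show thesis
  proof
    show "1 \<le> \<alpha>" "\<alpha> < 2" using \<eta> \<beta> by (auto simp: \<alpha>_def)
    show "0 < C" using M B c by (simp add: C_def)
    fix \<Phi> d assume \<Phi>: "noise_seminorm \<Phi> d N q" and d: "1 \<le> d"
    interpret noise_seminorm \<Phi> d N q by fact
    define D where "D = B * real d powr (1 + \<eta>)"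
    have D: "1 < D" unfolding D_def using B d \<eta> ge_one_powr_ge_zero[of "real d" "1 + \<eta>"]
      by (smt (verit) mult_le_cancel_left1 of_nat_1 of_nat_le_iff)
    let ?r0 = "1 / (2 * real d)"
    \<comment> \<open>\<open>L\<close> is the least constant that beats the crude bound \<open>exp D\<close> on the arc, and \<open>r\<close> solves
      \<open>L * r powr \<beta> = 1\<close>.\<close>
    define L where "L = D / (c * ?r0 powr \<beta>)"
    define r where "r = ?r0 * (c / D) powr (1 / \<beta>)"
    have r0: "0 < ?r0" using d by simp
    have cD: "0 < c / D" "c / D < 1" using c D by (auto simp: field_simps)
    have "ln (2 * (real d + 1) * (8 * real d) ^ d) \<le> D"
    proof -
      have "ln (2 * (real d + 1) * (8 * real d) ^ d) = ln (2 * (real d + 1)) + d * ln (8 * real d)"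
        using d by (simp add: ln_mult ln_realpow distrib_left)
      also have "\<dots> \<le> 2 * d * ln (8 * real d)"
      proof -
        have "ln (2 * (real d + 1)) \<le> 1 * ln (8 * real d)" using d by simp
        also have "\<dots> \<le> real d * ln (8 * real d)" using d by (intro mult_right_mono) auto
        finally show ?thesis by simp
      qed
      also have "\<dots> \<le> 2 * d * ((8 * real d) powr \<eta> / \<eta>)"
        using d \<eta> by (intro mult_left_mono ln_powr_bound) auto
      also have "\<dots> = 2 * 8 powr \<eta> / \<eta> * real d powr (1 + \<eta>)"
        using d by (simp add: powr_mult powr_add)
      also have "\<dots> \<le> D" unfolding D_def B_def by (intro mult_right_mono) auto
      finally show ?thesis .
    qed
    then have "exp (ln (2 * (real d + 1) * (8 * real d) ^ d)) \<le> exp D"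
      by (simp only: exp_le_cancel_iff)
    also have "exp (ln (2 * (real d + 1) * (8 * real d) ^ d)) = 2 * (real d + 1) * (8 * real d) ^ d"
      using d by (intro exp_ln) auto
    also have "D = L * c * ?r0 powr \<beta>"
      using c r0 by (simp add: L_def)
    finally have "\<Phi> (\<lambda>k. of_nat k) \<le> (6 * resolvent_bound N q + 1) / r * \<Phi> (\<lambda>k. 1)"
    proof (intro derivative_bound[where \<beta> = \<beta> and L = L])
      show "0 < r" using d c D by (simp add: r_def)
      have "(c / D) powr (1 / \<beta>) < 1 powr (1 / \<beta>)"
        using cD \<beta> by (intro powr_less_mono2) auto
      then show "r < ?r0" unfolding r_def using r0 by (metis mult.right_neutral mult_strict_left_mono powr_one_eq_one)
      have "r powr \<beta> = ?r0 powr \<beta> * (c / D)"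
        using c D \<beta> unfolding r_def by (subst powr_mult) (simp add: powr_powr)
      then show "L * r powr \<beta> \<le> 1" using c D d by (simp add: L_def)
      show "0 \<le> L" using c D by (simp add: L_def)
    qed (use d \<beta> in \<open>auto simp: c_def \<kappa>_def M_def\<close>)
    also have "(6 * resolvent_bound N q + 1) / r = C * real d powr \<alpha>"
    proof -
      have "(c / D) powr (1 / \<beta>) = 1 / ((B / c) powr (1 / \<beta>) * real d powr ((1 + \<eta>) / \<beta>))"
        using c B d \<beta> by (simp add: D_def powr_divide powr_mult powr_powr)
      then show ?thesis using d
        by (simp add: r_def C_def M_def \<alpha>_def powr_add)
    qed
    finally show "\<Phi> (\<lambda>k. of_nat k) \<le> C * real d powr \<alpha> * \<Phi> (\<lambda>k. 1)" .
  qed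
qed

section \<open>Fourier multipliers on the cube\<close>

lemma scaleC_zero_left [simp]: "0 *\<^sub>C (x :: 'a::complex_banach) = 0"
  using norm_scaleC[of 0 x] by simp

lemma scaleC_zero_right [simp]: "a *\<^sub>C (0 :: 'a::complex_banach) = 0"
  using norm_scaleC[of a "0 :: 'a"] by simp

lemma scaleC_scaleR: "a *\<^sub>C (r *\<^sub>R (x :: 'a::complex_banach)) = r *\<^sub>R (a *\<^sub>C x)"
  by (simp add: scaleR_scaleC scaleC_scaleC mult.commute)

lemma scaleC_sum_right: "a *\<^sub>C (\<Sum>i\<in>I. f i) = (\<Sum>i\<in>I. a *\<^sub>C (f i :: 'a::complex_banach))"
  by (induction I rule: infinite_finite_induct) (auto simp: scaleC_add_right)

definition walsh_poly ::
    "nat \<Rightarrow> (nat set \<Rightarrow> 'a::complex_banach) \<Rightarrow> (nat set \<Rightarrow> complex) \<Rightarrow> (nat \<Rightarrow> real) \<Rightarrow> 'a" where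
  "walsh_poly n x c \<epsilon> = (\<Sum>A\<in>Pow {1..n}. walsh A \<epsilon> *\<^sub>R (c A *\<^sub>C x A))"

lemma walsh_poly_add: "walsh_poly n x (\<lambda>A. a A + b A) \<epsilon> = walsh_poly n x a \<epsilon> + walsh_poly n x b \<epsilon>"
  by (simp add: walsh_poly_def scaleC_add_left scaleR_add_right sum.distrib)

lemma walsh_poly_scale: "walsh_poly n x (\<lambda>A. z * a A) \<epsilon> = z *\<^sub>C walsh_poly n x a \<epsilon>"
  by (simp add: walsh_poly_def scaleC_sum_right scaleC_scaleR scaleC_scaleC)

lemma walsh_poly_sum: "finite I \<Longrightarrow> walsh_poly n x (\<lambda>A. \<Sum>i\<in>I. f i A) \<epsilon> = (\<Sum>i\<in>I. walsh_poly n x (f i) \<epsilon>)"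
proof (induction I rule: finite_induct)
  case empty
  then show ?case by (simp add: walsh_poly_def)
next
  case (insert i I)
  then show ?case by (simp add: walsh_poly_add)
qed

locale walsh_multipliers =
  fixes n :: nat and p :: real and x :: "nat set \<Rightarrow> 'a::complex_banach"
  assumes p: "1 < p"
begin

definition \<Psi> :: "(nat set \<Rightarrow> complex) \<Rightarrow> real" where
  "\<Psi> c = Lp_norm p n (walsh_poly n x c)"

lemma \<Psi>_nonneg: "0 \<le> \<Psi> c"
  by (simp add: \<Psi>_def Lp_norm_nonneg)

lemma \<Psi>_cong: "(\<And>A. A \<subseteq> {1..n} \<Longrightarrow> a A = b A) \<Longrightarrow> \<Psi> a = \<Psi> b"
  unfolding \<Psi>_def by (intro Lp_norm_cong) (simp add: walsh_poly_def)

lemma \<Psi>_scale: "\<Psi> (\<lambda>A. z * c A) = cmod z * \<Psi> c"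
  unfolding \<Psi>_def using p by (intro Lp_norm_scale) (auto simp: walsh_poly_scale norm_scaleC)

lemma \<Psi>_add: "\<Psi> (\<lambda>A. a A + b A) \<le> \<Psi> a + \<Psi> b"
  unfolding \<Psi>_def using Lp_norm_triangle[of p n "walsh_poly n x a" "walsh_poly n x b"] p
  by (simp add: walsh_poly_add[abs_def])

lemma \<Psi>_sum:
  assumes "finite I"
  shows "\<Psi> (\<lambda>A. \<Sum>i\<in>I. f i A) \<le> (\<Sum>i\<in>I. \<Psi> (f i))"
proof -
  have "walsh_poly n x (\<lambda>A. \<Sum>i\<in>I. f i A) = (\<lambda>\<epsilon>. \<Sum>i\<in>I. walsh_poly n x (f i) \<epsilon>)"
    using assms by (intro ext walsh_poly_sum)
  then show ?thesis
    unfolding \<Psi>_def using Lp_norm_sum[of p I n "\<lambda>i. walsh_poly n x (f i)"] p assms by simp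
qed

text \<open>The multiplier of the conditional expectation that integrates out the coordinates in \<open>S\<close>: a Walsh function survives it
exactly if it does not involve these coordinates.\<close>

definition miss :: "nat set \<Rightarrow> nat set \<Rightarrow> complex" where
  "miss S A = (if A \<inter> S = {} then 1 else 0)"

text \<open>Multiplying the coordinates in \<open>S\<close> by fixed signs permutes the points of the cube.\<close>

lemma \<Psi>_flip:
  assumes \<delta>: "\<And>i. \<delta> i = 1 \<or> \<delta> i = -1" and S: "S \<subseteq> {1..n}"
  shows "\<Psi> (\<lambda>A. of_real (walsh (A \<inter> S) \<delta>) * c A) = \<Psi> c"
proof -
  define T where "T \<epsilon> i = (if i \<in> S then \<delta> i * \<epsilon> i else \<epsilon> i)" for \<epsilon> :: "nat \<Rightarrow> real" and i
  have \<delta>2: "\<delta> i * (\<delta> i * y) = y" for i y using \<delta>[of i] by auto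
  have TT: "T (T \<epsilon>) = \<epsilon>" for \<epsilon> by (auto simp: T_def \<delta>2)
  have Tcube: "T \<epsilon> \<in> cube n" if "\<epsilon> \<in> cube n" for \<epsilon>
    unfolding cube_def
  proof (rule PiE_I)
    fix i assume "i \<in> {1..n}"
    then show "T \<epsilon> i \<in> {-1, 1}" using cubeD[OF that, of i] \<delta>[of i] by (auto simp: T_def)
  next
    fix i assume "i \<notin> {1..n}"
    then show "T \<epsilon> i = undefined" using that S by (auto simp: T_def cube_def)
  qed
  have w: "walsh A (T \<epsilon>) = walsh (A \<inter> S) \<delta> * walsh A \<epsilon>" if "A \<subseteq> {1..n}" for A \<epsilon>
  proof -
    have fin: "finite A" using that finite_subset by blast
    have "walsh A (T \<epsilon>) = (\<Prod>i\<in>A. (if i \<in> S then \<delta> i else 1) * \<epsilon> i)"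
      unfolding walsh_def T_def by (intro prod.cong) auto
    also have "\<dots> = (\<Prod>i\<in>A. if i \<in> S then \<delta> i else 1) * walsh A \<epsilon>"
      by (simp add: prod.distrib walsh_def)
    also have "(\<Prod>i\<in>A. if i \<in> S then \<delta> i else 1) = walsh (A \<inter> S) \<delta>"
      using fin by (simp add: walsh_def prod.inter_restrict)
    finally show ?thesis .
  qed
  have "walsh_poly n x (\<lambda>A. of_real (walsh (A \<inter> S) \<delta>) * c A) \<epsilon> = walsh_poly n x c (T \<epsilon>)" for \<epsilon>
    unfolding walsh_poly_def by (intro sum.cong refl) (simp add: w scaleR_scaleC scaleC_scaleC mult_ac)
  moreover have "(\<Sum>\<epsilon>\<in>cube n. norm (walsh_poly n x c (T \<epsilon>)) powr p) = (\<Sum>\<epsilon>\<in>cube n. norm (walsh_poly n x c \<epsilon>) powr p)"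
    by (rule sum.reindex_bij_witness[of _ T T]) (auto simp: TT Tcube)
  ultimately show ?thesis by (simp add: \<Psi>_def Lp_norm_def)
qed

lemma sum_walsh_cube:
  assumes "A \<subseteq> {1..n}"
  shows "(\<Sum>\<delta>\<in>cube n. walsh A \<delta>) = (if A = {} then 2 ^ n else 0)"
proof (cases "A = {}")
  case True
  then show ?thesis by (simp add: walsh_def card_cube)
next
  case False
  have "(\<Sum>\<delta>\<in>cube n. walsh A \<delta>) = (\<Sum>\<delta>\<in>cube n. \<Prod>i\<in>{1..n}. if i \<in> A then \<delta> i else 1)"
    using assms by (intro sum.cong refl) (simp add: walsh_def Int_absorb1 flip: prod.inter_restrict)
  also have "\<dots> = (\<Prod>i\<in>{1..n}. \<Sum>y\<in>{-1, 1}. if i \<in> A then y else 1)"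
    unfolding cube_def by (rule prod_sum_PiE[symmetric]) auto
  also have "\<dots> = 0" using assms False by (intro prod_zero) auto
  finally show ?thesis using False by simp
qed

text \<open>Conditional expectation is the average of the isometries \<open>\<Psi>_flip\<close> over all choices of the signs.\<close>

lemma \<Psi>_miss_le:
  assumes S: "S \<subseteq> {1..n}"
  shows "\<Psi> (\<lambda>A. miss S A * c A) \<le> \<Psi> c"
proof -
  \<comment> \<open>A point of the cube is undefined outside \<open>{1..n}\<close>; \<open>ext\<close> extends it by the neutral sign.\<close>
  define ext where "ext \<delta> i = (if i \<in> {1..n} then \<delta> i else 1)" for \<delta> :: "nat \<Rightarrow> real" and i
  have ext: "ext \<delta> i = 1 \<or> ext \<delta> i = -1" if "\<delta> \<in> cube n" for \<delta> i
    using cubeD[OF that, of i] by (auto simp: ext_def)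
  have "\<Psi> (\<lambda>A. miss S A * c A) = \<Psi> (\<lambda>A. \<Sum>\<delta>\<in>cube n. (1 / 2 ^ n) * (of_real (walsh (A \<inter> S) (ext \<delta>)) * c A))"
  proof (rule \<Psi>_cong)
    fix A :: "nat set" assume A: "A \<subseteq> {1..n}"
    have "(\<Sum>\<delta>\<in>cube n. walsh (A \<inter> S) (ext \<delta>)) = (\<Sum>\<delta>\<in>cube n. walsh (A \<inter> S) \<delta>)"
      unfolding walsh_def ext_def using A by (intro sum.cong prod.cong) auto
    also have "\<dots> = (if A \<inter> S = {} then 2 ^ n else 0)" using A by (intro sum_walsh_cube) auto
    finally have "miss S A = (1 / 2 ^ n) * of_real (\<Sum>\<delta>\<in>cube n. walsh (A \<inter> S) (ext \<delta>))"
      by (simp add: miss_def)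
    then show "miss S A * c A = (\<Sum>\<delta>\<in>cube n. (1 / 2 ^ n) * (of_real (walsh (A \<inter> S) (ext \<delta>)) * c A))"
      by (simp only: of_real_sum sum_distrib_left sum_distrib_right mult.assoc)
  qed
  also have "\<dots> \<le> (\<Sum>\<delta>\<in>cube n. \<Psi> (\<lambda>A. (1 / 2 ^ n) * (of_real (walsh (A \<inter> S) (ext \<delta>)) * c A)))"
    by (intro \<Psi>_sum) auto
  also have "\<dots> = (\<Sum>\<delta>\<in>cube n. (1 / 2 ^ n) * \<Psi> c)"
    unfolding \<Psi>_scale using ext S by (intro sum.cong refl) (simp add: norm_divide norm_power \<Psi>_flip)
  also have "\<dots> = \<Psi> c" by (simp add: card_cube)
  finally show ?thesis .
qed

text \<open>The inequality for vectors, summed over the points of the cube, holds on average over \<open>\<epsilon>\<close>, hence for some \<open>\<epsilon>\<close>.\<close>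

lemma sign_sum_exists:
  fixes m :: nat and \<theta> :: real and c :: "(nat \<Rightarrow> real) \<Rightarrow> nat set \<Rightarrow> complex"
  assumes \<theta>: "0 < \<theta>"
    and signs: "\<And>v :: (nat \<Rightarrow> real) \<Rightarrow> 'a.
      (\<Sum>\<epsilon>\<in>cube m. norm (\<Sum>\<delta>\<in>cube m. sign_of (cube_inner m \<epsilon> \<delta>) *\<^sub>R v \<delta>) powr p)
        \<le> \<theta> * (2 ^ m) powr p * (\<Sum>\<delta>\<in>cube m. norm (v \<delta>) powr p)"
    and B: "\<And>\<delta>. \<delta> \<in> cube m \<Longrightarrow> \<Psi> (c \<delta>) \<le> B"
  shows "\<exists>\<epsilon>. \<Psi> (\<lambda>A. \<Sum>\<delta>\<in>cube m. of_real (sign_of (cube_inner m \<epsilon> \<delta>)) * c \<delta> A) \<le> \<theta> powr (1 / p) * 2 ^ m * B"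
proof -
  obtain \<delta>\<^sub>0 where "\<delta>\<^sub>0 \<in> cube m" using cube_nonempty by blast
  then have B0: "0 \<le> B" using B \<Psi>_nonneg order_trans by blast
  let ?N = "2 ^ m :: real"
  define y where "y \<delta> = walsh_poly n x (c \<delta>)" for \<delta>
  define h where "h \<epsilon> \<omega> = norm (\<Sum>\<delta>\<in>cube m. sign_of (cube_inner m \<epsilon> \<delta>) *\<^sub>R y \<delta> \<omega>) powr p" for \<epsilon> \<omega>
  have "(\<Sum>\<epsilon>\<in>cube m. \<Sum>\<omega>\<in>cube n. h \<epsilon> \<omega>) = (\<Sum>\<omega>\<in>cube n. \<Sum>\<epsilon>\<in>cube m. h \<epsilon> \<omega>)" by (rule sum.swap)
  also have "\<dots> \<le> (\<Sum>\<omega>\<in>cube n. \<theta> * ?N powr p * (\<Sum>\<delta>\<in>cube m. norm (y \<delta> \<omega>) powr p))"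
    unfolding h_def by (intro sum_mono signs)
  also have "\<dots> = \<theta> * ?N powr p * (\<Sum>\<delta>\<in>cube m. \<Sum>\<omega>\<in>cube n. norm (y \<delta> \<omega>) powr p)"
    by (subst sum.swap) (simp add: sum_distrib_left)
  also have "\<dots> \<le> \<theta> * ?N powr p * (\<Sum>\<delta>\<in>cube m. 2 ^ n * B powr p)"
    using \<theta> B B0 p by (intro mult_left_mono sum_mono) (auto simp: y_def \<Psi>_def Lp_norm_le_iff)
  also have "\<dots> = (\<Sum>\<epsilon>\<in>cube m. 2 ^ n * (\<theta> powr (1 / p) * ?N * B) powr p)"
    using \<theta> p B0 by (simp add: card_cube powr_mult powr_powr)
  finally have le: "(\<Sum>\<epsilon>\<in>cube m. \<Sum>\<omega>\<in>cube n. h \<epsilon> \<omega>) \<le> (\<Sum>\<epsilon>\<in>cube m. 2 ^ n * (\<theta> powr (1 / p) * ?N * B) powr p)" .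
  obtain \<epsilon> where \<epsilon>: "\<epsilon> \<in> cube m" "(\<Sum>\<omega>\<in>cube n. h \<epsilon> \<omega>) \<le> 2 ^ n * (\<theta> powr (1 / p) * ?N * B) powr p"
  proof (rule ccontr)
    assume "\<not> thesis"
    then have "\<And>\<epsilon>. \<epsilon> \<in> cube m \<Longrightarrow> 2 ^ n * (\<theta> powr (1 / p) * ?N * B) powr p < (\<Sum>\<omega>\<in>cube n. h \<epsilon> \<omega>)"
      using that by fastforce
    then have "(\<Sum>\<epsilon>\<in>cube m. 2 ^ n * (\<theta> powr (1 / p) * ?N * B) powr p) < (\<Sum>\<epsilon>\<in>cube m. \<Sum>\<omega>\<in>cube n. h \<epsilon> \<omega>)"
      using cube_nonempty by (intro sum_strict_mono) auto
    with le show False by linarith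
  qed
  have "walsh_poly n x (\<lambda>A. \<Sum>\<delta>\<in>cube m. of_real (sign_of (cube_inner m \<epsilon> \<delta>)) * c \<delta> A) \<omega>
      = (\<Sum>\<delta>\<in>cube m. sign_of (cube_inner m \<epsilon> \<delta>) *\<^sub>R y \<delta> \<omega>)" for \<omega>
    by (simp add: walsh_poly_sum walsh_poly_scale y_def scaleR_scaleC)
  then have "\<Psi> (\<lambda>A. \<Sum>\<delta>\<in>cube m. of_real (sign_of (cube_inner m \<epsilon> \<delta>)) * c \<delta> A) \<le> \<theta> powr (1 / p) * ?N * B"
    unfolding \<Psi>_def using \<epsilon>(2) p B0 \<theta> by (subst Lp_norm_le_iff) (auto simp: h_def)
  then show ?thesis by blast
qed

text \<open>Pisier's lemma for the projections \<open>miss (S j)\<close>, indexed by the \<open>2 ^ m\<close> points \<open>j\<close> of a cube. Let \<open>P B\<close> be the product of those with \<open>j \<in> B\<close>. The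
product of the \<open>1 - miss (S j)\<close> is the alternating sum of the \<open>2 ^ (2 ^ m)\<close> contractions \<open>P X\<close>. Choose signs \<open>s\<close> for
which the sum of the \<open>s j \<cdot> miss (S j)\<close> improves on the trivial bound \<open>2 ^ m\<close>, and let \<open>B\<close> be the set where \<open>s\<close> is positive. Applying
\<open>P B\<close> turns this sum into the sum of the \<open>s i \<cdot> P (insert i B)\<close>, and up to one global sign these are terms of the
alternating sum. Adding up \<open>2 ^ m\<close> copies of the alternating sum, with one of these terms singled out in each, saves
a fixed amount over the triangle inequality.\<close>

lemma prod_hit_le:
  fixes m :: nat and \<theta> :: real and S :: "(nat \<Rightarrow> real) \<Rightarrow> nat set"
  assumes \<theta>: "0 < \<theta>"
    and signs: "\<And>v :: (nat \<Rightarrow> real) \<Rightarrow> 'a.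
      (\<Sum>\<epsilon>\<in>cube m. norm (\<Sum>\<delta>\<in>cube m. sign_of (cube_inner m \<epsilon> \<delta>) *\<^sub>R v \<delta>) powr p)
        \<le> \<theta> * (2 ^ m) powr p * (\<Sum>\<delta>\<in>cube m. norm (v \<delta>) powr p)"
    and S: "\<And>j. j \<in> cube m \<Longrightarrow> S j \<subseteq> {1..n}"
  shows "\<Psi> (\<lambda>A. (\<Prod>j\<in>cube m. 1 - miss (S j) A) * c A) \<le> (2 ^ (2 ^ m) - 1 + \<theta> powr (1 / p)) * \<Psi> c"
proof -
  define J where "J = cube m"
  have J: "finite J" "card J = 2 ^ m" by (auto simp: J_def card_cube)
  define P where "P B A = (\<Prod>j\<in>B. miss (S j) A)" for B A
  have P_eq: "P B A = miss (\<Union>j\<in>B. S j) A" if "B \<subseteq> J" for B A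
  proof -
    have "finite B" using that J finite_subset by blast
    then show ?thesis unfolding P_def by (induction B rule: finite_induct) (auto simp: miss_def)
  qed
  have P_le: "\<Psi> (\<lambda>A. P B A * c A) \<le> \<Psi> c" if "B \<subseteq> J" for B c
  proof -
    have "(\<Union>j\<in>B. S j) \<subseteq> {1..n}"
      using that S unfolding J_def by (meson UN_least subsetD)
    then have "\<Psi> (\<lambda>A. miss (\<Union>j\<in>B. S j) A * c A) \<le> \<Psi> c" by (rule \<Psi>_miss_le)
    then show ?thesis unfolding P_eq[OF that] .
  qed
  have P_insert: "P B A * miss (S i) A = P (insert i B) A" if "B \<subseteq> J" for B i A
    using that finite_subset[OF that J(1)] by (cases "i \<in> B") (auto simp: P_def prod.insert_if mult.commute miss_def)
  define D where "D A = (\<Prod>j\<in>J. 1 - miss (S j) A)" for A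
  have D: "D A = (\<Sum>X\<in>Pow J. (-1) ^ card X * P X A)" for A
    using prod_add[OF J(1), of "\<lambda>j. - miss (S j) A" "\<lambda>_. 1"] by (simp add: D_def P_def prod_uminus)
  have "\<exists>\<epsilon>. \<Psi> (\<lambda>A. \<Sum>\<delta>\<in>cube m. of_real (sign_of (cube_inner m \<epsilon> \<delta>)) * (miss (S \<delta>) A * c A)) \<le> \<theta> powr (1 / p) * 2 ^ m * \<Psi> c"
    using S by (intro sign_sum_exists \<theta> signs \<Psi>_miss_le)
  then obtain \<epsilon> where \<epsilon>: "\<Psi> (\<lambda>A. \<Sum>\<delta>\<in>cube m. of_real (sign_of (cube_inner m \<epsilon> \<delta>)) * (miss (S \<delta>) A * c A)) \<le> \<theta> powr (1 / p) * 2 ^ m * \<Psi> c" ..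
  define s where "s \<delta> = sign_of (cube_inner m \<epsilon> \<delta>)" for \<delta>
  have s: "s j = 1 \<or> s j = -1" for j by (simp add: s_def sign_of_def)
  have s_le: "\<Psi> (\<lambda>A. \<Sum>j\<in>J. of_real (s j) * (miss (S j) A * c A)) \<le> \<theta> powr (1 / p) * 2 ^ m * \<Psi> c"
    using \<epsilon> by (simp only: s_def J_def)
  define B where "B = {j \<in> J. s j = 1}"
  have B: "B \<subseteq> J" "finite B" using J by (auto simp: B_def)
  have sgn: "(-1) ^ card B * (-1) ^ card (insert i B) = complex_of_real (s i)" if "i \<in> J" for i
  proof (cases "i \<in> B")
    case True
    then have "s i = 1" by (simp add: B_def)
    then show ?thesis using True by (simp add: insert_absorb flip: power_mult_distrib)
  next
    case False
    then have "s i = -1" using s[of i] that by (auto simp: B_def)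
    then show ?thesis using False B by (simp flip: power_mult_distrib)
  qed
  have split: "(-1) ^ card B * (D A * c A) = P B A * (of_real (s i) * (miss (S i) A * c A))
      + (\<Sum>X\<in>Pow J - {insert i B}. (-1) ^ (card B + card X) * (P X A * c A))" if i: "i \<in> J" for i A
  proof -
    have "(-1) ^ card B * (D A * c A) = (\<Sum>X\<in>Pow J. (-1) ^ (card B + card X) * (P X A * c A))"
      by (simp add: D sum_distrib_left sum_distrib_right power_add mult.assoc)
    also have "\<dots> = (-1) ^ (card B + card (insert i B)) * (P (insert i B) A * c A)
      + (\<Sum>X\<in>Pow J - {insert i B}. (-1) ^ (card B + card X) * (P X A * c A))"
      using J B i by (intro sum.remove) auto
    also have "(-1) ^ (card B + card (insert i B)) * (P (insert i B) A * c A) = P B A * (of_real (s i) * (miss (S i) A * c A))"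
      using sgn[OF i] by (simp add: power_add mult_ac flip: P_insert[OF B(1)])
    finally show ?thesis .
  qed
  have rest: "\<Psi> (\<lambda>A. \<Sum>X\<in>Pow J - {insert i B}. (-1) ^ (card B + card X) * (P X A * c A)) \<le> (2 ^ (2 ^ m) - 1) * \<Psi> c"
    if i: "i \<in> J" for i
  proof -
    have "\<Psi> (\<lambda>A. \<Sum>X\<in>Pow J - {insert i B}. (-1) ^ (card B + card X) * (P X A * c A))
      \<le> (\<Sum>X\<in>Pow J - {insert i B}. \<Psi> (\<lambda>A. (-1) ^ (card B + card X) * (P X A * c A)))"
      using J by (intro \<Psi>_sum) auto
    also have "\<dots> \<le> (\<Sum>X\<in>Pow J - {insert i B}. \<Psi> c)"
      by (intro sum_mono) (auto simp: \<Psi>_scale norm_power intro: P_le)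
    also have "\<dots> = real (card (Pow J) - 1) * \<Psi> c"
      using i B J by (simp add: card_Diff_singleton)
    also have "\<dots> = (2 ^ (2 ^ m) - 1) * \<Psi> c" using J by (simp add: card_Pow of_nat_diff)
    finally show ?thesis .
  qed
  have "2 ^ m * \<Psi> (\<lambda>A. D A * c A) = \<Psi> (\<lambda>A. 2 ^ m * ((-1) ^ card B * (D A * c A)))"
    by (simp add: \<Psi>_scale norm_power)
  also have "(\<lambda>A. 2 ^ m * ((-1) ^ card B * (D A * c A))) = (\<lambda>A. \<Sum>i\<in>J. (-1) ^ card B * (D A * c A))"
    using J by simp
  also have "\<dots> = (\<lambda>A. P B A * (\<Sum>i\<in>J. of_real (s i) * (miss (S i) A * c A))
      + (\<Sum>i\<in>J. \<Sum>X\<in>Pow J - {insert i B}. (-1) ^ (card B + card X) * (P X A * c A)))"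
    by (simp add: split sum.distrib flip: sum_distrib_left)
  also have "\<Psi> \<dots> \<le> \<Psi> (\<lambda>A. P B A * (\<Sum>i\<in>J. of_real (s i) * (miss (S i) A * c A)))
      + \<Psi> (\<lambda>A. \<Sum>i\<in>J. \<Sum>X\<in>Pow J - {insert i B}. (-1) ^ (card B + card X) * (P X A * c A))"
    by (rule \<Psi>_add)
  also have "\<Psi> (\<lambda>A. P B A * (\<Sum>i\<in>J. of_real (s i) * (miss (S i) A * c A))) \<le> \<theta> powr (1 / p) * 2 ^ m * \<Psi> c"
    using P_le[OF B(1)] s_le order_trans by blast
  also have "\<Psi> (\<lambda>A. \<Sum>i\<in>J. \<Sum>X\<in>Pow J - {insert i B}. (-1) ^ (card B + card X) * (P X A * c A))
      \<le> (\<Sum>i\<in>J. (2 ^ (2 ^ m) - 1) * \<Psi> c)"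
    by (rule order_trans[OF \<Psi>_sum[OF J(1)]]) (intro sum_mono rest)
  also have "\<theta> powr (1 / p) * 2 ^ m * \<Psi> c + (\<Sum>i\<in>J. (2 ^ (2 ^ m) - 1) * \<Psi> c) =
      2 ^ m * ((2 ^ (2 ^ m) - 1 + \<theta> powr (1 / p)) * \<Psi> c)"
    using J by (simp add: algebra_simps)
  finally show ?thesis by (simp add: D_def J_def)
qed

text \<open>The probability of \<open>S\<close> if each coordinate is chosen independently with probability \<open>1 - \<rho>\<close>.\<close>

definition subset_weight :: "real \<Rightarrow> nat set \<Rightarrow> real" where
  "subset_weight \<rho> S = (1 - \<rho>) ^ card S * \<rho> ^ card ({1..n} - S)"

lemma subset_weight_nonneg: "0 \<le> \<rho> \<Longrightarrow> \<rho> \<le> 1 \<Longrightarrow> 0 \<le> subset_weight \<rho> S"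
  by (simp add: subset_weight_def)

lemma sum_subset_weight: "(\<Sum>S\<in>Pow {1..n}. subset_weight \<rho> S) = 1"
  using prod_add[of "{1..n}" "\<lambda>_. 1 - \<rho>" "\<lambda>_. \<rho>"] by (simp add: subset_weight_def)

text \<open>The noise operator resamples a random set of coordinates: a Walsh function of degree \<open>k\<close> survives if
none of its \<open>k\<close> coordinates is chosen, which has probability \<open>\<rho> ^ k\<close>.\<close>

lemma sum_subset_weight_miss:
  assumes A: "A \<subseteq> {1..n}"
  shows "(\<Sum>S\<in>Pow {1..n}. of_real (subset_weight \<rho> S) * miss S A) = of_real \<rho> ^ card A"
proof -
  have "(\<Sum>S\<in>Pow {1..n}. of_real (subset_weight \<rho> S) * miss S A) =
      (\<Sum>S\<in>Pow {1..n}. (\<Prod>i\<in>S. if i \<in> A then 0 else 1 - of_real \<rho>) * (\<Prod>i\<in>{1..n} - S. complex_of_real \<rho>))"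
  proof (intro sum.cong refl)
    fix S assume S: "S \<in> Pow {1..n}"
    then have fin: "finite S" using finite_subset by blast
    show "of_real (subset_weight \<rho> S) * miss S A =
      (\<Prod>i\<in>S. if i \<in> A then 0 else 1 - of_real \<rho>) * (\<Prod>i\<in>{1..n} - S. complex_of_real \<rho>)"
    proof (cases "A \<inter> S = {}")
      case True
      then have "(\<Prod>i\<in>S. if i \<in> A then 0 else 1 - complex_of_real \<rho>) = (\<Prod>i\<in>S. 1 - of_real \<rho>)"
        by (intro prod.cong) auto
      then show ?thesis using True by (simp add: miss_def subset_weight_def)
    next
      case False
      then have "(\<Prod>i\<in>S. if i \<in> A then 0 else 1 - complex_of_real \<rho>) = 0"
        using fin by (intro prod_zero) auto
      then show ?thesis using False by (simp add: miss_def)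
    qed
  qed
  also have "\<dots> = (\<Prod>i\<in>{1..n}. (if i \<in> A then 0 else 1 - of_real \<rho>) + complex_of_real \<rho>)"
    by (rule prod_add[symmetric]) simp
  also have "\<dots> = (\<Prod>i\<in>{1..n}. if i \<in> A then complex_of_real \<rho> else 1)"
    by (intro prod.cong) auto
  also have "\<dots> = of_real \<rho> ^ card A"
    using A by (simp add: Int_absorb1 flip: prod.inter_restrict)
  finally show ?thesis .
qed

lemma noise_contraction:
  assumes \<rho>: "0 \<le> \<rho>" "\<rho> \<le> 1"
  shows "\<Psi> (\<lambda>A. of_real \<rho> ^ card A * c A) \<le> \<Psi> c"
proof -
  have "\<Psi> (\<lambda>A. of_real \<rho> ^ card A * c A) = \<Psi> (\<lambda>A. \<Sum>S\<in>Pow {1..n}. of_real (subset_weight \<rho> S) * (miss S A * c A))"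
    by (rule \<Psi>_cong) (simp add: sum_subset_weight_miss[symmetric] sum_distrib_right mult.assoc)
  also have "\<dots> \<le> (\<Sum>S\<in>Pow {1..n}. \<Psi> (\<lambda>A. of_real (subset_weight \<rho> S) * (miss S A * c A)))"
    by (rule \<Psi>_sum) simp
  also have "\<dots> \<le> (\<Sum>S\<in>Pow {1..n}. subset_weight \<rho> S * \<Psi> c)"
    unfolding \<Psi>_scale using subset_weight_nonneg[OF \<rho>] by (intro sum_mono) (auto intro!: mult_left_mono \<Psi>_miss_le)
  also have "\<dots> = \<Psi> c" by (simp only: sum_distrib_right[symmetric] sum_subset_weight mult_1)
  finally show ?thesis .
qed

text \<open>The \<open>2 ^ m\<close> factors \<open>1 - T\<close> are averaged over independent random sets, which turns the power into an average of
the products in \<open>prod_hit_le\<close>.\<close>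

lemma noise_power_gap:
  fixes m :: nat and \<theta> :: real
  assumes \<rho>: "0 \<le> \<rho>" "\<rho> \<le> 1" and \<theta>: "0 < \<theta>"
    and signs: "\<And>v :: (nat \<Rightarrow> real) \<Rightarrow> 'a.
      (\<Sum>\<epsilon>\<in>cube m. norm (\<Sum>\<delta>\<in>cube m. sign_of (cube_inner m \<epsilon> \<delta>) *\<^sub>R v \<delta>) powr p)
        \<le> \<theta> * (2 ^ m) powr p * (\<Sum>\<delta>\<in>cube m. norm (v \<delta>) powr p)"
  shows "\<Psi> (\<lambda>A. (1 - of_real \<rho> ^ card A) ^ (2 ^ m) * c A) \<le> (2 ^ (2 ^ m) - 1 + \<theta> powr (1 / p)) * \<Psi> c"
proof -
  let ?E = "cube m \<rightarrow>\<^sub>E Pow {1..n}"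
  let ?w = "\<lambda>S. \<Prod>j\<in>cube m. subset_weight \<rho> (S j)"
  have fin: "finite ?E" by (intro finite_PiE) auto
  have w: "0 \<le> ?w S" for S using subset_weight_nonneg[OF \<rho>] by (intro prod_nonneg) auto
  have "\<Psi> (\<lambda>A. (1 - of_real \<rho> ^ card A) ^ (2 ^ m) * c A)
      = \<Psi> (\<lambda>A. \<Sum>S\<in>?E. of_real (?w S) * ((\<Prod>j\<in>cube m. 1 - miss (S j) A) * c A))"
  proof (rule \<Psi>_cong)
    fix A :: "nat set" assume A: "A \<subseteq> {1..n}"
    have "1 - of_real \<rho> ^ card A = (\<Sum>S\<in>Pow {1..n}. of_real (subset_weight \<rho> S) * (1 - miss S A))"
      using sum_subset_weight_miss[OF A, of \<rho>] sum_subset_weight[of \<rho>, THEN arg_cong, of complex_of_real]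
      by (simp add: right_diff_distrib sum_subtractf)
    then have "(1 - of_real \<rho> ^ card A) ^ (2 ^ m) = (\<Prod>j\<in>cube m. \<Sum>S\<in>Pow {1..n}. of_real (subset_weight \<rho> S) * (1 - miss S A))"
      by (simp add: card_cube)
    also have "\<dots> = (\<Sum>S\<in>?E. \<Prod>j\<in>cube m. of_real (subset_weight \<rho> (S j)) * (1 - miss (S j) A))"
      by (rule prod_sum_PiE) auto
    finally show "(1 - of_real \<rho> ^ card A) ^ (2 ^ m) * c A =
        (\<Sum>S\<in>?E. of_real (?w S) * ((\<Prod>j\<in>cube m. 1 - miss (S j) A) * c A))"
      by (simp add: prod.distrib sum_distrib_right mult.assoc)
  qed
  also have "\<dots> \<le> (\<Sum>S\<in>?E. \<Psi> (\<lambda>A. of_real (?w S) * ((\<Prod>j\<in>cube m. 1 - miss (S j) A) * c A)))"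
    using fin by (rule \<Psi>_sum)
  also have "\<dots> \<le> (\<Sum>S\<in>?E. ?w S * ((2 ^ (2 ^ m) - 1 + \<theta> powr (1 / p)) * \<Psi> c))"
  proof (rule sum_mono)
    fix S assume S: "S \<in> ?E"
    then have "\<Psi> (\<lambda>A. (\<Prod>j\<in>cube m. 1 - miss (S j) A) * c A) \<le> (2 ^ (2 ^ m) - 1 + \<theta> powr (1 / p)) * \<Psi> c"
      by (intro prod_hit_le[OF \<theta> signs]) auto
    then show "\<Psi> (\<lambda>A. of_real (?w S) * ((\<Prod>j\<in>cube m. 1 - miss (S j) A) * c A))
        \<le> ?w S * ((2 ^ (2 ^ m) - 1 + \<theta> powr (1 / p)) * \<Psi> c)"
      unfolding \<Psi>_scale using w[of S] by (simp add: mult_left_mono del: of_real_prod)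
  qed
  also have "\<dots> = (\<Sum>S\<in>?E. ?w S) * ((2 ^ (2 ^ m) - 1 + \<theta> powr (1 / p)) * \<Psi> c)"
    by (rule sum_distrib_right[symmetric])
  also have "(\<Sum>S\<in>?E. ?w S) = (\<Prod>j\<in>cube m. \<Sum>S\<in>Pow {1..n}. subset_weight \<rho> S)"
    by (rule prod_sum_PiE[symmetric]) auto
  finally show ?thesis by (simp only: sum_subset_weight prod.neutral_const mult_1)
qed

end

section \<open>The Bernstein inequality\<close>

lemma walsh_expansion:
  assumes \<epsilon>: "\<epsilon> \<in> cube n"
  shows "(\<Sum>A\<in>Pow {1..n}. walsh A \<epsilon> *\<^sub>R walsh_coeff n f A) = f \<epsilon>"
proof -
  have kernel: "(\<Sum>A\<in>Pow {1..n}. walsh A \<epsilon> * walsh A \<delta>) = (if \<delta> = \<epsilon> then 2 ^ n else 0)" if \<delta>: "\<delta> \<in> cube n" for \<delta>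
  proof -
    have "(\<Sum>A\<in>Pow {1..n}. walsh A \<epsilon> * walsh A \<delta>) = (\<Prod>i\<in>{1..n}. \<epsilon> i * \<delta> i + 1)"
      using prod_add[of "{1..n}" "\<lambda>i. \<epsilon> i * \<delta> i" "\<lambda>_. 1"] by (simp add: walsh_def prod.distrib)
    also have "\<dots> = (if \<delta> = \<epsilon> then 2 ^ n else 0)"
    proof (cases "\<delta> = \<epsilon>")
      case True
      have "(\<Prod>i\<in>{1..n}. \<epsilon> i * \<epsilon> i + 1) = (\<Prod>i\<in>{1..n}. 2 :: real)"
        using cube_square[OF \<epsilon>] by (intro prod.cong) auto
      then show ?thesis using True by simp
    next
      case False
      then obtain i where i: "i \<in> {1..n}" "\<delta> i \<noteq> \<epsilon> i"
        using PiE_ext[of \<delta> "{1..n}" "\<lambda>_. {-1, 1}" \<epsilon>] \<epsilon> \<delta> unfolding cube_def by (metis insert_commute)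
      then have "\<epsilon> i * \<delta> i + 1 = 0" using cubeD[OF \<epsilon> i(1)] cubeD[OF \<delta> i(1)] by auto
      then have "(\<Prod>i\<in>{1..n}. \<epsilon> i * \<delta> i + 1) = 0" using i(1) by (intro prod_zero) auto
      then show ?thesis using False by simp
    qed
    finally show ?thesis .
  qed
  have "(\<Sum>A\<in>Pow {1..n}. walsh A \<epsilon> *\<^sub>R walsh_coeff n f A)
      = (\<Sum>A\<in>Pow {1..n}. \<Sum>\<delta>\<in>cube n. (1 / 2 ^ n * (walsh A \<epsilon> * walsh A \<delta>)) *\<^sub>R f \<delta>)"
    by (simp add: walsh_coeff_def scaleR_sum_right mult_ac)
  also have "\<dots> = (\<Sum>\<delta>\<in>cube n. (1 / 2 ^ n * (\<Sum>A\<in>Pow {1..n}. walsh A \<epsilon> * walsh A \<delta>)) *\<^sub>R f \<delta>)"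
    by (subst sum.swap) (simp only: scaleR_sum_left sum_distrib_left)
  also have "\<dots> = (\<Sum>\<delta>\<in>cube n. if \<delta> = \<epsilon> then f \<delta> else 0)"
    by (intro sum.cong refl) (subst kernel, auto)
  finally show ?thesis using \<epsilon> by simp
qed

theorem theorem8:
  fixes p :: real
  assumes "K_convex TYPE('a::complex_banach)"
    and "1 < p"
  shows "\<exists>\<alpha> C :: real. 1 \<le> \<alpha> \<and> \<alpha> < 2 \<and> 0 < C \<and>
    (\<forall>n d :: nat. \<forall>f :: (nat \<Rightarrow> real) \<Rightarrow> 'a.
       1 \<le> d \<and> d \<le> n \<and> degree_at_most n d f \<longrightarrow>
       Lp_norm p n (laplacian n f) \<le> C * real d powr \<alpha> * Lp_norm p n f)"
proof -
  obtain m \<theta> where \<theta>: "0 < \<theta>" "\<theta> < 1" and signs: "\<And>v :: (nat \<Rightarrow> real) \<Rightarrow> 'a.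
      (\<Sum>\<epsilon>\<in>cube m. norm (\<Sum>\<delta>\<in>cube m. sign_of (cube_inner m \<epsilon> \<delta>) *\<^sub>R v \<delta>) powr p)
        \<le> \<theta> * (2 ^ m) powr p * (\<Sum>\<delta>\<in>cube m. norm (v \<delta>) powr p)"
    using K_convex_sign_sums[OF assms] by blast
  define N :: nat where "N = 2 ^ m"
  define q where "q = (2 ^ N - 1 + \<theta> powr (1 / p)) / 2 ^ N"
  have \<theta>p: "0 < \<theta> powr (1 / p)" "\<theta> powr (1 / p) < 1"
    using \<theta> assms(2) powr_less_mono2[of "1 / p" \<theta> 1] by auto
  have q: "0 \<le> q" "q < 1" "q * 2 ^ N = 2 ^ N - 1 + \<theta> powr (1 / p)"
  proof -
    have "1 \<le> (2 :: real) ^ N" by simp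
    then have "0 \<le> 2 ^ N - 1 + \<theta> powr (1 / p)" using \<theta>p by linarith
    then show "0 \<le> q" "q < 1" "q * 2 ^ N = 2 ^ N - 1 + \<theta> powr (1 / p)"
      using \<theta>p by (simp_all add: q_def)
  qed
  obtain \<alpha> C where \<alpha>: "1 \<le> \<alpha>" "\<alpha> < 2" "0 < C"
    and deriv: "\<And>\<Phi> d. noise_seminorm \<Phi> d N q \<Longrightarrow> 1 \<le> d \<Longrightarrow>
       \<Phi> (\<lambda>k. of_nat k) \<le> C * real d powr \<alpha> * \<Phi> (\<lambda>k. 1)"
    using noise_seminorm_derivative by blast
  have "Lp_norm p n (laplacian n f) \<le> C * real d powr \<alpha> * Lp_norm p n f"
    if d: "1 \<le> d" and deg: "degree_at_most n d f" for n d and f :: "(nat \<Rightarrow> real) \<Rightarrow> 'a"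
  proof -
    define x where "x = walsh_coeff n f"
    interpret walsh_multipliers n p x by unfold_locales (rule assms(2))
    define \<Phi> where "\<Phi> a = \<Psi> (\<lambda>A. a (card A))" for a :: "nat \<Rightarrow> complex"
    have "noise_seminorm \<Phi> d N q"
    proof
      fix a b :: "nat \<Rightarrow> complex" and z :: complex and \<rho> :: real
      show "\<Phi> (\<lambda>k. a k + b k) \<le> \<Phi> a + \<Phi> b" unfolding \<Phi>_def by (rule \<Psi>_add)
      show "\<Phi> (\<lambda>k. z * a k) = cmod z * \<Phi> a" unfolding \<Phi>_def by (rule \<Psi>_scale)
      show "\<Phi> a = \<Phi> b" if ab: "\<And>k. k \<le> d \<Longrightarrow> a k = b k"
      proof -
        have "a (card A) *\<^sub>C x A = b (card A) *\<^sub>C x A" if "A \<subseteq> {1..n}" for A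
          using ab[of "card A"] deg that by (cases "card A \<le> d") (auto simp: degree_at_most_def x_def)
        then show ?thesis
          unfolding \<Phi>_def \<Psi>_def by (intro Lp_norm_cong) (simp add: walsh_poly_def)
      qed
      show "0 \<le> q" "q < 1" by fact+
      show "1 \<le> N" by (simp add: N_def)
      assume \<rho>: "0 \<le> \<rho>" "\<rho> \<le> 1"
      show "\<Phi> (\<lambda>k. of_real \<rho> ^ k * a k) \<le> \<Phi> a"
        unfolding \<Phi>_def using \<rho> by (rule noise_contraction)
      show "\<Phi> (\<lambda>k. (1 - of_real \<rho> ^ k) ^ N * a k) \<le> q * 2 ^ N * \<Phi> a"
        unfolding \<Phi>_def q(3)[unfolded N_def] N_def using \<rho> \<theta>(1) signs by (rule noise_power_gap)
    qed
    then have "\<Phi> (\<lambda>k. of_nat k) \<le> C * real d powr \<alpha> * \<Phi> (\<lambda>k. 1)"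
      using d by (rule deriv)
    moreover have "\<Phi> (\<lambda>k. 1) = Lp_norm p n f"
      unfolding \<Phi>_def \<Psi>_def
      by (intro Lp_norm_cong) (simp only: walsh_poly_def x_def scaleC_one walsh_expansion)
    moreover have "\<Phi> (\<lambda>k. of_nat k) = Lp_norm p n (laplacian n f)"
      unfolding \<Phi>_def \<Psi>_def
    proof (intro Lp_norm_cong)
      have "of_nat k *\<^sub>C y = real k *\<^sub>R y" for k and y :: 'a
        by (simp add: scaleR_scaleC)
      then show "walsh_poly n x (\<lambda>A. of_nat (card A)) \<epsilon> = laplacian n f \<epsilon>" for \<epsilon>
        by (simp add: walsh_poly_def laplacian_def x_def mult.commute)
    qed
    ultimately show ?thesis by simp
  qed
  with \<alpha> show ?thesis by blast
qed

end
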